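(* Let $(D_n)_{n\in\mathbb N}$ be a sequence of subsets of $\mathbb Z^d$ satisfying the geometric assumption, with scaling vectors $\mathbf c_n$. Let $(\xi_v)_{v\in\mathbb Z^d}$ be a stationary real-valued random field such that, for every $0<\tau<\infty$, a sequence $x_n=x_n(\tau)$ is chosen with $|D_n|\,\mathbb P(\xi_0>x_n(\tau))\to\tau$ and the field satisfies condition $\mathcal D(x_n(\tau);K_n)$, with mixing constants $\alpha_n=\alpha_n(\tau)$ and $\boldsymbol\gamma_n=\boldsymbol\gamma_n(\tau)$. Let $\theta\in[0,1]$. Then the field has extremal index $\theta$ with respect to $(D_n)$ if and only if there exists (for each $\tau>0$) a sequence $k_n=k_n(\tau)$ satisfying $k_n\to\infty$, $k_n\alpha_n\to0$ and $k_n^{1/d}\boldsymbol\gamma_n=o(\mathbf c_n)$ as $n\to\infty$, such that condition $\mathcal D^\ell(x_n(\tau);k_n(\tau);\theta)$ is satisfied for all $\tau>0$.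
   Context: Notation: $d\in\mathbb N$; $|\cdot|$ denotes the Euclidean norm of a point, Lebesgue measure of a full-dimensional subset of $\mathbb R^d$, and cardinality of a subset of $\mathbb Z^d$. For a vector $\mathbf r=(r_1,\dots,r_d)$ and $A\subseteq\mathbb R^d$, $\mathbf rA=\{(r_1a_1,\dots,r_da_d):a\in A\}$. $A\oplus B$ is the Minkowski sum, $B(1)$ the closed Euclidean unit ball. For vectors, $\mathbf r_n=o(\mathbf c_n)$ means $r_{n,\ell}/c_{n,\ell}\to0$ for each $\ell$. $M_\xi(A)=\max_{v\in A}\xi_v$, with $M_\xi(\emptyset)=-\infty$. Geometric assumption on $(D_n)$: A convex body is a compact convex subset of $\mathbb R^d$ with non-empty interior; a set is $p$-convex if it is a union of $p$ convex bodies. There are $p\in\mathbb N$ and $p$-convex sets $C_n=\bigcup_{i=1}^pC_{n,i}$ with $D_n=C_n\cap\mathbb Z^d$ and $|C_n|\to\infty$, and vectors $\mathbf c_n=(c_{n,1},\dots,c_{n,d})$ (scaling vectors) with $0<c_{n,\ell}<\infty$ such that (i) $c_{n,\ell}\to\infty$ for all $\ell$; (ii) $c_{n,1}\cdots c_{n,d}\sim|C_n|$; (iii) for some $0<c<\infty$, $C_n\subseteq\mathbf c_n[-c,c]^d$ for all $n$. Boxes: every sequence $(k_n)$ considered consists of positive integers with $k_n\to\infty$ and $k_n^{1/d}=o(c_{n,\ell})$ for all $\ell$. Put $t_{n,k_n}^\ell=\lfloor c_{n,\ell}/k_n^{1/d}\rfloor$, $\mathbf t_{n,k_n}=(t_{n,k_n}^1,\dots,t_{n,k_n}^d)$,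 and for $z\in\mathbb Z^d$, $I_z^{n,k_n}=\mathbf t_{n,k_n}(z+[0,1)^d)$, $J_z^{n,k_n}=I_z^{n,k_n}\cap\mathbb Z^d$, and $D_{n,k_n}^+=\bigcup\{J_z^{n,k_n}: I_z^{n,k_n}\cap C_n\ne\emptyset\}$. $K_n=\mathbb Z^d\cap\mathbf c_n[-c,c]^d$, where $0<c<\infty$ is a fixed constant (which can be chosen independently of $(k_n)$) such that $D_{n,k_n}^+\subseteq K_n$ for all $n$. Condition $\mathcal D(x_n;K_n)$: sets $A,B\subseteq\mathbb Z^d$ are $\boldsymbol\gamma$-separated if $B\subseteq(A\oplus\boldsymbol\gamma B(1))^c$. The condition holds for $(\xi_v)$ if there is an increasing sequence of $d$-dimensional vectors $\boldsymbol\gamma_n$ with $\boldsymbol\gamma_n=o(\mathbf c_n)$ and constants $\alpha_n\to0$ such that for all $n$ and all $\boldsymbol\gamma_n$-separated $A,B\subseteq K_n$, at least one of which is a box, $|\mathbb P(M_\xi(A\cup B)\le x_n)-\mathbb P(M_\xi(A)\le x_n)\mathbb P(M_\xi(B)\le x_n)|\le\alpha_n$. Order: $\preceq$ is an arbitrary fixed translation invariant total order on $\mathbb Z^d$, and $A_v^{n,k_n}=\{z\in(v+\mathbf t_{n,k_n}[-1,1]^d)\cap\mathbb Z^d: v\prec z\}$. Condition $\mathcal D^\ell(x_n;k_n;\theta)$ ($\theta\in[0,1]$): $\mathbb P(M_\xi(A_0^{n,k_n})\le x_n\mid\xi_0>x_n)\to\theta$ as $n\to\infty$. Extremal index: the stationary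 field $(\xi_v)$ has extremal index $\theta\in[0,1]$ with respect to $(D_n)$ if for each $\tau>0$ there exists a sequence $x_n(\tau)$ such that $|D_n|\,\mathbb P(\xi_0>x_n(\tau))\to\tau$ and $\mathbb P(M_\xi(D_n)\le x_n(\tau))\to\exp(-\theta\tau)$ as $n\to\infty$. *)

theory Defs
  imports "HOL-Probability.Probability" "HOL-Library.Landau_Symbols"
begin

text \<open>
  The dimension is \<open>d = CARD('d)\<close>; lattice points are elements of \<open>int^'d\<close>.
  Multiplication on vectors is componentwise, so \<open>(*) r ` A\<close> is the scaled set \<open>r A\<close> for a
  vector \<open>r\<close>, and \<open>A + B\<close> is the Minkowski sum of two sets. The order on vectors
  is componentwise, too.
\<close>

definition real_vec :: "int^'d::finite \<Rightarrow> real^'d" where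
  "real_vec z = (\<chi> l. of_int (z $ l))"

definition lattice_points :: "(real^'d::finite) set \<Rightarrow> (int^'d) set" where
  "lattice_points S = {z. real_vec z \<in> S}"

definition cube :: "real \<Rightarrow> (real^'d::finite) set" where
  "cube b = {a. \<forall>l. - b \<le> a $ l \<and> a $ l \<le> b}"

definition unit_cell :: "(real^'d::finite) set" where
  "unit_cell = {a. \<forall>l. 0 \<le> a $ l \<and> a $ l < 1}"

definition vec_smallo :: "(nat \<Rightarrow> real^'d::finite) \<Rightarrow> (nat \<Rightarrow> real^'d) \<Rightarrow> bool" where
  "vec_smallo r c \<longleftrightarrow> (\<forall>l. (\<lambda>n. r n $ l / c n $ l) \<longlonglongrightarrow> 0)"


subsection \<open>Geometry of the index sets\<close>

definition convex_body :: "(real^'d::finite) set \<Rightarrow> bool" where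
  "convex_body B \<longleftrightarrow> compact B \<and> convex B \<and> interior B \<noteq> {}"

definition p_convex :: "nat \<Rightarrow> (real^'d::finite) set \<Rightarrow> bool" where
  "p_convex p S \<longleftrightarrow> (\<exists>B. (\<forall>i\<in>{1..p}. convex_body (B i)) \<and> S = (\<Union>i\<in>{1..p}. B i))"

definition geometric_assumption ::
  "(nat \<Rightarrow> (int^'d::finite) set) \<Rightarrow> (nat \<Rightarrow> (real^'d) set) \<Rightarrow> (nat \<Rightarrow> real^'d) \<Rightarrow> bool" where
  "geometric_assumption D C c \<longleftrightarrow>
     (\<exists>p. \<forall>n. p_convex p (C n)) \<and>
     (\<forall>n. D n = lattice_points (C n)) \<and>
     filterlim (\<lambda>n. measure lebesgue (C n)) at_top sequentially \<and>
     (\<forall>n l. 0 < c n $ l) \<and>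
     (\<forall>l. filterlim (\<lambda>n. c n $ l) at_top sequentially) \<and>
     (\<lambda>n. \<Prod>l\<in>UNIV. c n $ l) \<sim>[sequentially] (\<lambda>n. measure lebesgue (C n)) \<and>
     (\<exists>b>0. \<forall>n. C n \<subseteq> (*) (c n) ` cube b)"

definition admissible :: "(nat \<Rightarrow> real^'d::finite) \<Rightarrow> (nat \<Rightarrow> nat) \<Rightarrow> bool" where
  "admissible c k \<longleftrightarrow>
     (\<forall>n. 0 < k n) \<and> filterlim k at_top sequentially \<and>
     (\<forall>l. (\<lambda>n. root CARD('d) (real (k n)) / c n $ l) \<longlonglongrightarrow> 0)"

text \<open>
  In the following definitions \<open>c\<close>, \<open>k\<close> and \<open>C\<close> are the values \<open>c\<^sub>n\<close>, \<open>k\<^sub>n\<close> and \<open>C\<^sub>n\<close> at a single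
  index \<open>n\<close>.
\<close>

definition side_lengths :: "real^'d::finite \<Rightarrow> nat \<Rightarrow> real^'d" where
  "side_lengths c k = (\<chi> l. of_int \<lfloor>c $ l / root CARD('d) (real k)\<rfloor>)"

definition real_cell :: "real^'d::finite \<Rightarrow> nat \<Rightarrow> int^'d \<Rightarrow> (real^'d) set" where
  "real_cell c k z = (*) (side_lengths c k) ` ((+) (real_vec z) ` unit_cell)"

definition lattice_cell :: "real^'d::finite \<Rightarrow> nat \<Rightarrow> int^'d \<Rightarrow> (int^'d) set" where
  "lattice_cell c k z = lattice_points (real_cell c k z)"

definition outer_cells :: "real^'d::finite \<Rightarrow> (real^'d) set \<Rightarrow> nat \<Rightarrow> (int^'d) set" where
  "outer_cells c C k = \<Union>{lattice_cell c k z | z. real_cell c k z \<inter> C \<noteq> {}}"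

definition window :: "real^'d::finite \<Rightarrow> real \<Rightarrow> (int^'d) set" where
  "window c \<kappa> = lattice_points ((*) c ` cube \<kappa>)"


subsection \<open>Random fields\<close>

definition random_field :: "'a measure \<Rightarrow> (int^'d::finite \<Rightarrow> 'a \<Rightarrow> real) \<Rightarrow> bool" where
  "random_field M \<xi> \<longleftrightarrow> (\<forall>v. \<xi> v \<in> borel_measurable M)"

definition stationary :: "'a measure \<Rightarrow> (int^'d::finite \<Rightarrow> 'a \<Rightarrow> real) \<Rightarrow> bool" where
  "stationary M \<xi> \<longleftrightarrow>
     (\<forall>h. distr M (Pi\<^sub>M UNIV (\<lambda>_. borel)) (\<lambda>\<omega> v. \<xi> (v + h) \<omega>)
        = distr M (Pi\<^sub>M UNIV (\<lambda>_. borel)) (\<lambda>\<omega> v. \<xi> v \<omega>))"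

text \<open>The supremum in \<open>ereal\<close> is a maximum for finite nonempty index sets and \<open>-\<infinity>\<close> for the empty set.\<close>

definition field_max :: "(int^'d::finite \<Rightarrow> 'a \<Rightarrow> real) \<Rightarrow> (int^'d) set \<Rightarrow> 'a \<Rightarrow> ereal" where
  "field_max \<xi> A \<omega> = (SUP v\<in>A. ereal (\<xi> v \<omega>))"

definition separated :: "real^'d::finite \<Rightarrow> (int^'d) set \<Rightarrow> (int^'d) set \<Rightarrow> bool" where
  "separated \<gamma> A B \<longleftrightarrow> real_vec ` B \<subseteq> - (real_vec ` A + (*) \<gamma> ` cball 0 1)"

definition lattice_box :: "(int^'d::finite) set \<Rightarrow> bool" where
  "lattice_box A \<longleftrightarrow> (\<exists>a b. A = {a..b})"

text \<open>The mixing condition for given \<open>\<alpha>\<close> and \<open>\<gamma>\<close>; \<open>c\<close> are the scaling vectors.\<close>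

definition mixing_condition ::
  "'a measure \<Rightarrow> (int^'d::finite \<Rightarrow> 'a \<Rightarrow> real) \<Rightarrow> (nat \<Rightarrow> real^'d) \<Rightarrow>
   (nat \<Rightarrow> real) \<Rightarrow> (nat \<Rightarrow> (int^'d) set) \<Rightarrow> (nat \<Rightarrow> real) \<Rightarrow> (nat \<Rightarrow> real^'d) \<Rightarrow> bool" where
  "mixing_condition M \<xi> c x K \<alpha> \<gamma> \<longleftrightarrow>
     incseq \<gamma> \<and> vec_smallo \<gamma> c \<and> \<alpha> \<longlonglongrightarrow> 0 \<and>
     (\<forall>n A B. A \<subseteq> K n \<longrightarrow> B \<subseteq> K n \<longrightarrow> separated (\<gamma> n) A B \<longrightarrow> lattice_box A \<or> lattice_box B \<longrightarrow>
        \<bar>\<P>(\<omega> in M. field_max \<xi> (A \<union> B) \<omega> \<le> ereal (x n))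
          - \<P>(\<omega> in M. field_max \<xi> A \<omega> \<le> ereal (x n)) * \<P>(\<omega> in M. field_max \<xi> B \<omega> \<le> ereal (x n))\<bar>
        \<le> \<alpha> n)"

definition translation_invariant :: "((int^'d::finite) \<times> (int^'d)) set \<Rightarrow> bool" where
  "translation_invariant R \<longleftrightarrow> (\<forall>u v h. (u, v) \<in> R \<longleftrightarrow> (u + h, v + h) \<in> R)"

definition successors ::
  "((int^'d::finite) \<times> (int^'d)) set \<Rightarrow> real^'d \<Rightarrow> nat \<Rightarrow> int^'d \<Rightarrow> (int^'d) set" where
  "successors R c k v =
     {z \<in> lattice_points ((+) (real_vec v) ` ((*) (side_lengths c k) ` cube 1)). (v, z) \<in> R \<and> v \<noteq> z}"

definition local_condition ::
  "'a measure \<Rightarrow> (int^'d::finite \<Rightarrow> 'a \<Rightarrow> real) \<Rightarrow> ((int^'d) \<times> (int^'d)) set \<Rightarrow> (nat \<Rightarrow> real^'d) \<Rightarrow>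
   (nat \<Rightarrow> real) \<Rightarrow> (nat \<Rightarrow> nat) \<Rightarrow> real \<Rightarrow> bool" where
  "local_condition M \<xi> R c x k \<theta> \<longleftrightarrow>
     (\<lambda>n. \<P>(\<omega> in M. field_max \<xi> (successors R (c n) (k n) 0) \<omega> \<le> ereal (x n) \<bar> \<xi> 0 \<omega> > x n))
       \<longlonglongrightarrow> \<theta>"

definition has_extremal_index ::
  "'a measure \<Rightarrow> (int^'d::finite \<Rightarrow> 'a \<Rightarrow> real) \<Rightarrow> (nat \<Rightarrow> (int^'d) set) \<Rightarrow> real \<Rightarrow> bool" where
  "has_extremal_index M \<xi> D \<theta> \<longleftrightarrow>
     (\<forall>\<tau>>0. \<exists>x :: nat \<Rightarrow> real.
        (\<lambda>n. real (card (D n)) * \<P>(\<omega> in M. \<xi> 0 \<omega> > x n)) \<longlonglongrightarrow> \<tau> \<and>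
        (\<lambda>n. \<P>(\<omega> in M. field_max \<xi> (D n) \<omega> \<le> ereal (x n))) \<longlonglongrightarrow> exp (- \<theta> * \<tau>))"

end

theory Submission
  imports Defs
begin

text \<open>
  For every admissible block number \<open>k\<close> with \<open>k \<alpha> \<rightarrow> 0\<close> and negligible separation,
  \<open>P(M(D) \<le> x) - exp (- \<tau> \<pi>) \<rightarrow> 0\<close>, where \<open>\<pi>\<close> is the conditional probability in the local condition;
  as \<open>\<tau> > 0\<close>, both implications follow, and such \<open>k\<close> exist because they may grow arbitrarily slowly.

  For this asymptotic identity, replace \<open>D\<close> by the union of the \<open>N\<close> cells meeting \<open>C\<close>. Shrinking one cell
  after the other to its core, mixing gives \<open>P(M \<le> x) \<approx> (1 - q)^N \<approx> exp (- N q)\<close> with \<open>q = P(M(J) > x)\<close>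
  for one cell \<open>J\<close>. Decomposing an exceedance in \<open>J\<close> according to the last exceedance in the order gives
  \<open>q \<approx> |J| P(\<xi>\<^sub>0 > x, M(A\<^sub>0) \<le> x)\<close>, since an exceedance in \<open>J\<close> together with one in the adjacent
  cells outside \<open>J\<close> has probability \<open>O(1/k^2) + \<alpha> + o(1/k)\<close>.

  That the boundary cells do not matter, uniformly over convex sets in a box, rests on a monotonicity
  argument: a convex set is the intersection of \<open>2^d\<close> sets, each of which is antitone with respect to one
  of the orthants, and if \<open>L\<close> is antitone under the shift by \<open>s\<close>, then the part of \<open>L\<close> in a box \<open>B\<close> that
  leaves \<open>L\<close> under the shift has at most the volume of \<open>B - (B + s)\<close>.
\<close>

section \<open>Frontiers of unions of convex bodies\<close>

text \<open>The part \<open>P\<close> of \<open>L\<close> in the overlap of \<open>B\<close> and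
  \<open>B + s\<close>, moved back by \<open>s\<close>, stays in \<open>L \<inter> B\<close> by
  \<open>down\<close>, and it misses \<open>G\<close> because its points return to \<open>L\<close>
  under the shift. Hence \<open>G\<close> has at most the volume of \<open>L \<inter> B\<close>
  minus that of \<open>P\<close>, and this difference is bounded by the volume of \<open>B\<close>
  outside the overlap.\<close>

lemma measure_antimono_shift_le:
  fixes L :: "(real^'d::finite) set" and h s :: "real^'d"
  assumes "closed L" and down: "\<And>w. w + s \<in> L \<Longrightarrow> w \<in> L" and sh: "\<And>l. \<bar>s $ l\<bar> \<le> 2 * h $ l"
  defines "G \<equiv> {w \<in> cbox (- h) h. w \<in> L \<and> w + s \<notin> L}"
  shows "G \<in> lmeasurable"
    and "measure lebesgue G \<le> (\<Prod>l\<in>UNIV. 2 * h $ l) - (\<Prod>l\<in>UNIV. 2 * h $ l - \<bar>s $ l\<bar>)"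
proof -
  define B where "B = cbox (- h) h"
  define A where "A = L \<inter> B"
  define P where "P = L \<inter> (B \<inter> (+) s ` B)"
  define A' where "A' = (\<lambda>w. w - s) ` P"
  have h0: "0 \<le> h $ l" for l using sh[of l] abs_ge_zero[of "s $ l"] by linarith
  \<comment> \<open>The overlap is again a box, with sides
    \<open>2 * h $ l - \<bar>s $ l\<bar>\<close>; the bound on \<open>s\<close> keeps it non-empty,
    as the content formula requires.\<close>
  have BB: "B \<inter> (+) s ` B = cbox (\<chi> l. max (- h $ l) (s $ l - h $ l)) (\<chi> l. min (h $ l) (s $ l + h $ l))"
  proof -
    have "(+) s ` B = cbox (s - h) (s + h)"
      unfolding B_def using cbox_translation[of s "- h" h] by simp
    then show ?thesis unfolding B_def by (auto simp: mem_box_cart)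
  qed
  have Pc: "compact P" unfolding P_def BB using \<open>closed L\<close> by (intro closed_Int_compact compact_cbox)
  have Ac: "compact A" unfolding A_def B_def using \<open>closed L\<close> by (intro closed_Int_compact compact_cbox)
  have "closed ((\<lambda>w. w + s) -` L)"
    by (rule closed_vimage[OF \<open>closed L\<close>]) (intro continuous_intros)
  moreover have "G = A - (\<lambda>w. w + s) -` L" by (auto simp: G_def A_def B_def)
  ultimately show Gm: "G \<in> lmeasurable"
    using Ac by (metis fmeasurable_Diff lmeasurable_compact borel_closed sets_completionI_sets sets_lborel)
  have Pm: "P \<in> lmeasurable" and Am: "A \<in> lmeasurable" using Pc Ac by (auto intro: lmeasurable_compact)
  have Qm: "B - B \<inter> (+) s ` B \<in> lmeasurable"
    unfolding BB unfolding B_def by (intro fmeasurable_Diff) auto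
  have A'm: "A' \<in> lmeasurable" unfolding A'_def using Pm by (rule measurable_translation_subtract)
  have A'A: "A' \<subseteq> A" unfolding A'_def P_def A_def using down by (auto simp: algebra_simps)
  have "G \<subseteq> A - A'" unfolding A'_def P_def A_def G_def B_def by (auto simp: algebra_simps)
  then have "measure lebesgue G \<le> measure lebesgue (A - A')"
    using Gm Am A'm by (intro measure_mono_fmeasurable) (auto intro: fmeasurable_Diff)
  also have "\<dots> = measure lebesgue A - measure lebesgue A'"
    using Am A'm A'A by (rule measurable_measure_Diff[OF _ fmeasurableD])
  also have "measure lebesgue A' = measure lebesgue P"
    unfolding A'_def by (rule measure_translation_subtract)
  also have "measure lebesgue A \<le> measure lebesgue (P \<union> (B - B \<inter> (+) s ` B))"
    using Am Pm Qm by (intro measure_mono_fmeasurable) (auto simp: A_def P_def)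
  also have "\<dots> \<le> measure lebesgue P + measure lebesgue (B - B \<inter> (+) s ` B)"
    using Pm Qm by (intro measure_Un_le) auto
  also have "measure lebesgue (B - B \<inter> (+) s ` B) = measure lebesgue B - measure lebesgue (B \<inter> (+) s ` B)"
  proof (rule measurable_measure_Diff)
    show "B \<in> lmeasurable" "B \<inter> (+) s ` B \<in> sets lebesgue" unfolding BB by (auto simp: B_def)
  qed simp
  also have "measure lebesgue B = (\<Prod>l\<in>UNIV. 2 * h $ l)"
  proof -
    have "0 \<in> cbox (- h) h" using h0 by (simp add: mem_box_cart)
    then have "cbox (- h) h \<noteq> {}" by blast
    from content_cbox_cart[OF this] show ?thesis unfolding B_def by (simp add: measure_completion)
  qed
  also have "measure lebesgue (B \<inter> (+) s ` B) = (\<Prod>l\<in>UNIV. 2 * h $ l - \<bar>s $ l\<bar>)"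
  proof -
    have "(\<chi> l. max (- h $ l) (s $ l - h $ l)) \<in> cbox (\<chi> l. max (- h $ l) (s $ l - h $ l)) (\<chi> l. min (h $ l) (s $ l + h $ l))"
      unfolding mem_box_cart using sh h0 by (auto simp: abs_le_iff) (smt (verit) sh h0)+
    then have ne: "cbox (\<chi> l. max (- h $ l) (s $ l - h $ l)) (\<chi> l. min (h $ l) (s $ l + h $ l)) \<noteq> {}" by blast
    have "min (h $ l) (s $ l + h $ l) - max (- h $ l) (s $ l - h $ l) = 2 * h $ l - \<bar>s $ l\<bar>" for l
      by (auto simp: min_def max_def)
    then show ?thesis unfolding BB using content_cbox_cart[OF ne]
      by (subst measure_completion) (auto simp del: cbox_interval)
  qed
  finally show "measure lebesgue G \<le> (\<Prod>l\<in>UNIV. 2 * h $ l) - (\<Prod>l\<in>UNIV. 2 * h $ l - \<bar>s $ l\<bar>)" by simp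
qed

section \<open>Thickened boundaries and their volume\<close>

text \<open>A thickened boundary with its own radius in each coordinate, as the scaling vectors may
  be anisotropic. The form with two witnesses passes easily to unions.\<close>

definition box_frontier :: "(real^'d::finite) set \<Rightarrow> real^'d \<Rightarrow> (real^'d) set" where
  "box_frontier K r = {x. (\<exists>y\<in>K. \<forall>l. \<bar>y $ l - x $ l\<bar> \<le> r $ l) \<and> (\<exists>y. y \<notin> K \<and> (\<forall>l. \<bar>y $ l - x $ l\<bar> \<le> r $ l))}"

definition signs :: "(real^'d::finite) set" where
  "signs = {\<sigma>. \<forall>l. \<sigma> $ l \<in> {-1, 1}}"

lemma finite_signs: "finite (signs :: (real^'d::finite) set)"
proof -
  have "(signs :: (real^'d) set) \<subseteq> vec_lambda ` (UNIV \<rightarrow>\<^sub>E {-1, 1::real})"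
  proof
    fix s :: "real^'d" assume "s \<in> signs"
    then show "s \<in> vec_lambda ` (UNIV \<rightarrow>\<^sub>E {-1, 1::real})"
      by (intro image_eqI[where x="vec_nth s"]) (auto simp: signs_def)
  qed
  then show ?thesis by (rule finite_subset) (intro finite_imageI finite_PiE; simp)
qed

text \<open>For a sign vector \<open>\<sigma>\<close> this is the Minkowski sum of \<open>K\<close>
  with a closed orthant: \<open>K\<close> is enlarged to a set that is antitone in the coordinate
  order oriented by \<open>\<sigma>\<close>.\<close>

definition orthant_hull :: "real^'d::finite \<Rightarrow> (real^'d) set \<Rightarrow> (real^'d) set" where
  "orthant_hull \<sigma> K = {w. \<exists>y\<in>K. \<forall>l. \<sigma> $ l * w $ l \<le> \<sigma> $ l * y $ l}"

text \<open>The Minkowski sum of a compact and a closed set is closed.\<close>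

lemma closed_orthant_hull:
  assumes "compact K"
  shows "closed (orthant_hull \<sigma> K)"
proof -
  define Z where "Z = {u. \<forall>l. \<sigma> $ l * u $ l \<le> 0}"
  have "closed Z" unfolding Z_def by (intro closed_Collect_all closed_Collect_le continuous_intros)
  with assms have "closed (\<Union>x\<in>K. \<Union>y\<in>Z. {x + y})" by (rule compact_closed_sums)
  moreover have "orthant_hull \<sigma> K = (\<Union>x\<in>K. \<Union>y\<in>Z. {x + y})"
  proof (intro equalityI subsetI)
    fix w assume "w \<in> orthant_hull \<sigma> K"
    then obtain y where "y \<in> K" "\<forall>l. \<sigma> $ l * w $ l \<le> \<sigma> $ l * y $ l" by (auto simp: orthant_hull_def)
    then have "w - y \<in> Z" "w = y + (w - y)" by (auto simp: Z_def algebra_simps)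
    then show "w \<in> (\<Union>x\<in>K. \<Union>y\<in>Z. {x + y})" using \<open>y \<in> K\<close> by blast
  next
    fix w assume "w \<in> (\<Union>x\<in>K. \<Union>y\<in>Z. {x + y})"
    then obtain x y where "x \<in> K" "y \<in> Z" "w = x + y" by blast
    then have "\<forall>l. \<sigma> $ l * w $ l \<le> \<sigma> $ l * x $ l" by (simp add: Z_def algebra_simps)
    then show "w \<in> orthant_hull \<sigma> K" using \<open>x \<in> K\<close> unfolding orthant_hull_def by blast
  qed
  ultimately show ?thesis by simp
qed

text \<open>The signs of the normal of a separating hyperplane select an orthant avoiding the convex set.\<close>

lemma convex_avoids_orthant:
  fixes K :: "(real^'d::finite) set"
  assumes "compact K" "convex K" "y \<notin> K"
  obtains \<sigma> where "\<sigma> \<in> signs" "y \<notin> orthant_hull \<sigma> K"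
proof -
  obtain a b where ab: "inner a y < b" "\<And>x. x \<in> K \<Longrightarrow> b < inner a x"
    using separating_hyperplane_closed_point[OF assms(2) compact_imp_closed[OF assms(1)] assms(3)] by blast
  define \<sigma> :: "real^'d" where "\<sigma> = (\<chi> l. if 0 \<le> a $ l then -1 else 1)"
  have "y \<notin> orthant_hull \<sigma> K"
  proof
    assume "y \<in> orthant_hull \<sigma> K"
    then obtain x where x: "x \<in> K" "\<And>l. \<sigma> $ l * y $ l \<le> \<sigma> $ l * x $ l" by (auto simp: orthant_hull_def)
    have "a $ l * x $ l \<le> a $ l * y $ l" for l
      using x(2)[of l] by (auto simp: \<sigma>_def split: if_splits intro: mult_left_mono mult_left_mono_neg)
    then have "inner a x \<le> inner a y" unfolding inner_vec_def by (auto intro: sum_mono)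
    then show False using ab(1) ab(2)[OF x(1)] by linarith
  qed
  moreover have "\<sigma> \<in> signs" by (auto simp: \<sigma>_def signs_def)
  ultimately show ?thesis using that by blast
qed

text \<open>Let \<open>y \<in> K\<close> and \<open>y' \<notin> K\<close> lie in the box around
  \<open>x\<close>, and let \<open>\<sigma>\<close> be a sign vector whose hull avoids
  \<open>y'\<close>. In the order oriented by \<open>\<sigma>\<close>,
  \<open>x - \<sigma> * r\<close> lies below \<open>y\<close>, hence in the hull, while
  \<open>x + \<sigma> * r\<close> lies above \<open>y'\<close>, hence outside. So the shift by
  \<open>2 *\<^sub>R (\<sigma> * r)\<close> drives \<open>x - \<sigma> * r\<close> out of an
  antitone set, and the volume bound for such shifts applies once for each sign vector.\<close>

lemma box_frontier_convex_cover:
  fixes K :: "(real^'d::finite) set"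
  assumes K: "compact K" "convex K" and bound: "\<And>y l. y \<in> K \<Longrightarrow> \<bar>y $ l\<bar> \<le> b $ l"
    and r: "\<And>l. 0 \<le> r $ l" and b: "\<And>l. 0 \<le> b $ l"
  obtains S where "S \<in> lmeasurable" "box_frontier K r \<subseteq> S"
    "measure lebesgue S \<le> card (signs :: (real^'d) set) *
       ((\<Prod>l\<in>UNIV. 2 * b $ l + 4 * r $ l) - (\<Prod>l\<in>UNIV. 2 * b $ l + 2 * r $ l))"
proof -
  \<comment> \<open>Frontier points have coordinates of modulus at most \<open>b + r\<close>, and
    passing to \<open>x - \<sigma> * r\<close> adds another \<open>r\<close>.\<close>
  define h where "h = b + 2 *\<^sub>R r"
  define G where "G \<sigma> = {w \<in> cbox (- h) h. w \<in> orthant_hull \<sigma> K \<and> w + 2 *\<^sub>R (\<sigma> * r) \<notin> orthant_hull \<sigma> K}" for \<sigma>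
  define S where "S = (\<Union>\<sigma>\<in>signs. (+) (\<sigma> * r) ` G \<sigma>)"
  let ?m = "(\<Prod>l\<in>UNIV. 2 * b $ l + 4 * r $ l) - (\<Prod>l\<in>UNIV. 2 * b $ l + 2 * r $ l)"
  have ss: "\<bar>\<sigma> $ l\<bar> = 1" "\<sigma> $ l * \<sigma> $ l = 1" if "\<sigma> \<in> signs" for \<sigma> :: "real^'d" and l
    using that by (auto simp: signs_def) (metis abs_1 abs_minus_cancel insert_iff singletonD, metis mult_1 mult_minus1 minus_minus)
  have G: "G \<sigma> \<in> lmeasurable" "measure lebesgue (G \<sigma>) \<le> ?m" if \<sigma>: "\<sigma> \<in> signs" for \<sigma>
  proof -
    have 1: "w \<in> orthant_hull \<sigma> K" if "w + 2 *\<^sub>R (\<sigma> * r) \<in> orthant_hull \<sigma> K" for w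
    proof -
      have *: "\<exists>y\<in>K. \<forall>l. \<sigma> $ l * (w $ l + 2 * (\<sigma> $ l * r $ l)) \<le> \<sigma> $ l * y $ l"
        using that by (simp add: orthant_hull_def)
      obtain y where "y \<in> K" and y: "\<And>l. \<sigma> $ l * (w $ l + 2 * (\<sigma> $ l * r $ l)) \<le> \<sigma> $ l * y $ l"
        using * by blast
      have "\<sigma> $ l * w $ l \<le> \<sigma> $ l * y $ l" for l
      proof -
        have "\<sigma> $ l * (w $ l + 2 * (\<sigma> $ l * r $ l)) = \<sigma> $ l * w $ l + 2 * (\<sigma> $ l * \<sigma> $ l) * r $ l"
          by (simp add: algebra_simps)
        then show ?thesis using y[of l] r[of l] ss[OF \<sigma>] by simp
      qed
      then show ?thesis using \<open>y \<in> K\<close> by (auto simp: orthant_hull_def)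
    qed
    have sr: "\<bar>(2 *\<^sub>R (\<sigma> * r)) $ l\<bar> = 2 * r $ l" for l
      using ss(1)[OF \<sigma>] r[of l] by (simp add: abs_mult)
    have 2: "\<bar>(2 *\<^sub>R (\<sigma> * r)) $ l\<bar> \<le> 2 * h $ l" for l
      unfolding sr using b[of l] r[of l] by (simp add: h_def)
    note * = measure_antimono_shift_le[OF closed_orthant_hull[OF K(1), of \<sigma>] 1 2]
    show "G \<sigma> \<in> lmeasurable" using *(1) unfolding G_def .
    have "(\<Prod>l\<in>UNIV. 2 * h $ l - \<bar>(2 *\<^sub>R (\<sigma> * r)) $ l\<bar>) = (\<Prod>l\<in>UNIV. 2 * b $ l + 2 * r $ l)"
      unfolding sr by (simp add: h_def algebra_simps)
    moreover have "(\<Prod>l\<in>UNIV. 2 * h $ l) = (\<Prod>l\<in>UNIV. 2 * b $ l + 4 * r $ l)"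
      by (simp add: h_def algebra_simps)
    ultimately show "measure lebesgue (G \<sigma>) \<le> ?m" using *(2) unfolding G_def by simp
  qed
  have "S \<in> lmeasurable"
    unfolding S_def using finite_signs G(1) by (intro fmeasurable.finite_UN measurable_translation) auto
  moreover have "measure lebesgue S \<le> card (signs :: (real^'d) set) * ?m"
  proof -
    have "measure lebesgue S \<le> (\<Sum>\<sigma>\<in>signs. measure lebesgue ((+) (\<sigma> * r) ` G \<sigma>))"
      unfolding S_def using finite_signs G(1)
      by (intro measure_UNION_le) (auto intro!: fmeasurableD measurable_translation)
    also have "\<dots> \<le> (\<Sum>\<sigma>\<in>(signs :: (real^'d) set). ?m)"
      using G(2) by (intro sum_mono) (simp add: measure_translation)
    finally show ?thesis by simp
  qed
  moreover have "box_frontier K r \<subseteq> S"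
  proof
    fix x assume "x \<in> box_frontier K r"
    then obtain y y' where y: "y \<in> K" "\<And>l. \<bar>y $ l - x $ l\<bar> \<le> r $ l"
      and y': "y' \<notin> K" "\<And>l. \<bar>y' $ l - x $ l\<bar> \<le> r $ l" by (auto simp: box_frontier_def)
    obtain \<sigma> where \<sigma>: "\<sigma> \<in> signs" "y' \<notin> orthant_hull \<sigma> K"
      using convex_avoids_orthant[OF K y'(1)] by blast
    have c: "\<sigma> $ l = -1 \<or> \<sigma> $ l = 1" for l using \<sigma>(1) by (auto simp: signs_def)
    define w where "w = x - \<sigma> * r"
    have w1: "w \<in> orthant_hull \<sigma> K"
    proof -
      have "\<sigma> $ l * w $ l \<le> \<sigma> $ l * y $ l" for l
        using c[of l] y(2)[of l] by (auto simp: w_def abs_le_iff)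
      then show ?thesis using y(1) by (auto simp: orthant_hull_def)
    qed
    have w2: "w + 2 *\<^sub>R (\<sigma> * r) \<notin> orthant_hull \<sigma> K"
    proof
      assume "w + 2 *\<^sub>R (\<sigma> * r) \<in> orthant_hull \<sigma> K"
      then obtain u where u: "u \<in> K" "\<And>l. \<sigma> $ l * (w + 2 *\<^sub>R (\<sigma> * r)) $ l \<le> \<sigma> $ l * u $ l"
        by (auto simp: orthant_hull_def)
      have "\<sigma> $ l * y' $ l \<le> \<sigma> $ l * u $ l" for l
        using c[of l] y'(2)[of l] u(2)[of l] by (auto simp: w_def abs_le_iff)
      then show False using \<sigma>(2) u(1) by (auto simp: orthant_hull_def)
    qed
    have "\<bar>w $ l\<bar> \<le> h $ l" for l
      using c[of l] y(2)[of l] bound[OF y(1), of l] r[of l] by (auto simp: w_def h_def abs_le_iff)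
    then have "w \<in> cbox (- h) h" by (auto simp: mem_box_cart abs_le_iff) (metis minus_le_iff)
    then have "w \<in> G \<sigma>" using w1 w2 by (simp add: G_def)
    then have "x \<in> (+) (\<sigma> * r) ` G \<sigma>" by (intro image_eqI[where x=w]) (auto simp: w_def)
    then show "x \<in> S" using \<sigma>(1) by (auto simp: S_def)
  qed
  ultimately show ?thesis using that by blast
qed

text \<open>A box that meets the union and its complement meets one of the bodies and the complement
  of that same body, so the covers of the single bodies together cover the frontier.\<close>

lemma box_frontier_p_convex_cover:
  fixes C :: "(real^'d::finite) set"
  assumes "p_convex p C" and bound: "\<And>y l. y \<in> C \<Longrightarrow> \<bar>y $ l\<bar> \<le> b $ l"
    and r: "\<And>l. 0 \<le> r $ l" and b: "\<And>l. 0 \<le> b $ l"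
  obtains S where "S \<in> lmeasurable" "box_frontier C r \<subseteq> S"
    "measure lebesgue S \<le> p * (card (signs :: (real^'d) set) *
       ((\<Prod>l\<in>UNIV. 2 * b $ l + 4 * r $ l) - (\<Prod>l\<in>UNIV. 2 * b $ l + 2 * r $ l)))"
proof -
  let ?m = "card (signs :: (real^'d) set) *
       ((\<Prod>l\<in>UNIV. 2 * b $ l + 4 * r $ l) - (\<Prod>l\<in>UNIV. 2 * b $ l + 2 * r $ l))"
  obtain B where B: "\<And>i. i \<in> {1..p} \<Longrightarrow> convex_body (B i)" and C: "C = (\<Union>i\<in>{1..p}. B i)"
    using assms(1) unfolding p_convex_def by blast
  have "\<exists>S. S \<in> lmeasurable \<and> box_frontier (B i) r \<subseteq> S \<and> measure lebesgue S \<le> ?m" if "i \<in> {1..p}" for i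
  proof -
    have "compact (B i)" "convex (B i)" using B[OF that] by (auto simp: convex_body_def)
    moreover have *: "\<bar>y $ l\<bar> \<le> b $ l" if "y \<in> B i" for y l using C that \<open>i \<in> {1..p}\<close> by (intro bound) blast
    ultimately show ?thesis by (rule box_frontier_convex_cover[OF _ _ _ r b]) (assumption | intro exI conjI)+
  qed
  then have "\<forall>i\<in>{1..p}. \<exists>S. S \<in> lmeasurable \<and> box_frontier (B i) r \<subseteq> S \<and> measure lebesgue S \<le> ?m"
    by (rule ballI)
  from bchoice[OF this] obtain S where
    S: "\<forall>i\<in>{1..p}. S i \<in> lmeasurable \<and> box_frontier (B i) r \<subseteq> S i \<and> measure lebesgue (S i) \<le> ?m"
    by (rule exE)
  show thesis
  proof (rule that[of "\<Union>i\<in>{1..p}. S i"])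
    show "(\<Union>i\<in>{1..p}. S i) \<in> lmeasurable" using S by (intro fmeasurable.finite_UN) auto
    show "box_frontier C r \<subseteq> (\<Union>i\<in>{1..p}. S i)"
    proof
      fix x assume "x \<in> box_frontier C r"
      then obtain i where "i \<in> {1..p}" "x \<in> box_frontier (B i) r" unfolding box_frontier_def C by blast
      then show "x \<in> (\<Union>i\<in>{1..p}. S i)" using S by blast
    qed
    have "measure lebesgue (\<Union>i\<in>{1..p}. S i) \<le> (\<Sum>i\<in>{1..p}. measure lebesgue (S i))"
      using S by (intro measure_UNION_le) (auto intro: fmeasurableD)
    also have "\<dots> \<le> (\<Sum>i\<in>{1..p}. ?m)" using S by (intro sum_mono) auto
    finally show "measure lebesgue (\<Union>i\<in>{1..p}. S i) \<le> p * ?m" by simp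
  qed
qed

section \<open>Lattice point counts against Lebesgue measure\<close>

text \<open>Half-open unit cubes are pairwise disjoint and tile the space, so cardinality becomes
  volume, and the cube of a point is found by taking floors.\<close>

definition cells :: "(int^'d::finite) set \<Rightarrow> (real^'d) set" where
  "cells A = (\<Union>v\<in>A. {x. \<forall>l. real_of_int (v $ l) \<le> x $ l \<and> x $ l < real_of_int (v $ l) + 1})"

lemma measure_cells:
  fixes A :: "(int^'d::finite) set"
  assumes "finite A"
  shows "cells A \<in> lmeasurable" "measure lebesgue (cells A) = card A"
proof -
  define U where "U v = {x::real^'d. \<forall>l. real_of_int (v $ l) \<le> x $ l \<and> x $ l < real_of_int (v $ l) + 1}" for v :: "int^'d"
  have U: "U v \<in> lmeasurable \<and> measure lebesgue (U v) = 1" for v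
  proof -
    \<comment> \<open>The half-open cube lies between an open and a closed box of the same content
      1.\<close>
    have 1: "box (real_vec v) (real_vec v + 1) \<subseteq> U v" "U v \<subseteq> cbox (real_vec v) (real_vec v + 1)"
      by (auto simp: U_def mem_box_cart real_vec_def less_imp_le)
    have ne: "cbox (real_vec v) (real_vec v + 1) \<noteq> {}"
      by (rule ex_in_conv[THEN iffD1], rule exI[of _ "real_vec v"]) (simp add: mem_box_cart)
    have m: "measure lebesgue (cbox (real_vec v) (real_vec v + 1)) = 1"
      using content_cbox_cart[OF ne] by (subst measure_completion) auto
    have Us: "U v \<in> sets borel"
    proof -
      have "U v = (\<Inter>l. {x. real_of_int (v $ l) \<le> x $ l} \<inter> {x. x $ l < real_of_int (v $ l) + 1})"
        by (auto simp: U_def)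
      also have "\<dots> \<in> sets borel"
        by (intro sets.countable_INT'' sets.Int borel_closed borel_open closed_Collect_le open_Collect_less continuous_intros) auto
      finally show ?thesis .
    qed
    then have Um: "U v \<in> lmeasurable"
      by (intro fmeasurableI2[OF _ 1(2)]) (auto intro: sets_completionI_sets)
    have "measure lborel (box (real_vec v) (real_vec v + 1)) = measure lborel (cbox (real_vec v) (real_vec v + 1))"
      by (simp only: measure_lborel_box_eq measure_lborel_cbox_eq)
    then have mb: "measure lebesgue (box (real_vec v) (real_vec v + 1)) = 1"
      using m by (simp add: measure_completion)
    have "box (real_vec v) (real_vec v + 1) \<in> sets lebesgue" by simp
    then have "1 \<le> measure lebesgue (U v)"
      using measure_mono_fmeasurable[OF 1(1) _ Um] mb by simp
    moreover have "measure lebesgue (U v) \<le> 1"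
      using measure_mono_fmeasurable[OF 1(2) fmeasurableD[OF Um]] m by simp
    ultimately have "measure lebesgue (U v) = 1" by simp
    then show ?thesis using Um by simp
  qed
  have eq: "cells A = (\<Union>v\<in>A. U v)" by (simp add: cells_def U_def)
  show "cells A \<in> lmeasurable" unfolding eq using assms U by (intro fmeasurable.finite_UN) auto
  have "disjoint_family_on U A"
  proof (unfold disjoint_family_on_def, intro ballI impI)
    fix v w :: "int^'d" assume "v \<noteq> w"
    have "v = w" if "x \<in> U v" "x \<in> U w" for x
    proof -
      have "v $ l = w $ l" for l
      proof -
        have "\<lfloor>x $ l\<rfloor> = v $ l" "\<lfloor>x $ l\<rfloor> = w $ l" using that by (auto simp: U_def floor_eq_iff)
        then show ?thesis by simp
      qed
      then show ?thesis by (simp add: vec_eq_iff)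
    qed
    then show "U v \<inter> U w = {}" using \<open>v \<noteq> w\<close> by auto
  qed
  then have "measure lebesgue (\<Union>v\<in>A. U v) = (\<Sum>v\<in>A. measure lebesgue (U v))"
    using assms U by (intro measure_UNION') (auto simp: disjoint_family_on_def pairwise_def disjnt_def)
  then show "measure lebesgue (cells A) = card A" unfolding eq using U by simp
qed

lemma mem_cells_floor: "x \<in> cells A \<longleftrightarrow> (\<chi> l. \<lfloor>x $ l\<rfloor>) \<in> A"
proof
  assume "x \<in> cells A"
  then obtain v where v: "v \<in> A" "\<And>l. real_of_int (v $ l) \<le> x $ l \<and> x $ l < real_of_int (v $ l) + 1"
    by (auto simp: cells_def)
  then have "\<lfloor>x $ l\<rfloor> = v $ l" for l by (simp add: floor_eq_iff)
  then have "(\<chi> l. \<lfloor>x $ l\<rfloor>) = v" by (simp add: vec_eq_iff)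
  with v(1) show "(\<chi> l. \<lfloor>x $ l\<rfloor>) \<in> A" by simp
next
  assume "(\<chi> l. \<lfloor>x $ l\<rfloor>) \<in> A"
  then show "x \<in> cells A"
    unfolding cells_def by (rule UN_I) (auto simp: floor_less_cancel)
qed

text \<open>If the floor of a point of \<open>C\<close> is not in \<open>C\<close>, the box of
  radius 1 around the point contains both the point itself and this floor, so the point belongs to
  the frontier.\<close>

lemma card_lattice_points_ge:
  fixes C :: "(real^'d::finite) set"
  assumes fin: "finite (lattice_points C)" and S: "S \<in> lmeasurable" "box_frontier C 1 \<subseteq> S"
    and C: "C \<in> sets lebesgue"
  shows "measure lebesgue C \<le> card (lattice_points C) + measure lebesgue S"
proof -
  have "C \<subseteq> cells (lattice_points C) \<union> S"
  proof
    fix x assume x: "x \<in> C"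
    show "x \<in> cells (lattice_points C) \<union> S"
    proof (cases "x \<in> cells (lattice_points C)")
      case False
      then have "real_vec (\<chi> l. \<lfloor>x $ l\<rfloor>) \<notin> C" by (simp add: mem_cells_floor lattice_points_def)
      moreover have "\<bar>real_vec (\<chi> l. \<lfloor>x $ l\<rfloor>) $ l - x $ l\<bar> \<le> 1" for l
        unfolding real_vec_def by (simp add: abs_le_iff) linarith
      ultimately have "x \<in> box_frontier C 1" using x unfolding box_frontier_def by force
      then show ?thesis using S(2) by blast
    qed simp
  qed
  then have "measure lebesgue C \<le> measure lebesgue (cells (lattice_points C) \<union> S)"
    using C measure_cells(1)[OF fin] S(1) by (intro measure_mono_fmeasurable) auto
  also have "\<dots> \<le> measure lebesgue (cells (lattice_points C)) + measure lebesgue S"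
    using measure_cells(1)[OF fin] S(1) by (intro measure_Un_le) auto
  finally show ?thesis using measure_cells(2)[OF fin] by simp
qed

text \<open>A point in the cube of a lattice point near \<open>C\<close> is itself near
  \<open>C\<close>, hence in \<open>C\<close> or in its frontier. The radius grows by 1 to cover the
  distance between a point and its floor.\<close>

lemma card_near_le:
  fixes C :: "(real^'d::finite) set"
  assumes fin: "finite A" and near: "\<And>v. v \<in> A \<Longrightarrow> \<exists>y\<in>C. \<forall>l. \<bar>y $ l - real_of_int (v $ l)\<bar> \<le> r $ l"
    and r: "\<And>l. 0 \<le> r $ l"
    and S: "S \<in> lmeasurable" "box_frontier C (r + 1) \<subseteq> S"
    and C: "C \<in> lmeasurable"
  shows "card A \<le> measure lebesgue C + measure lebesgue S"
proof -
  have "cells A \<subseteq> C \<union> S"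
  proof
    fix x assume "x \<in> cells A"
    then have "(\<chi> l. \<lfloor>x $ l\<rfloor>) \<in> A" by (simp add: mem_cells_floor)
    then obtain y where y: "y \<in> C" "\<And>l. \<bar>y $ l - real_of_int \<lfloor>x $ l\<rfloor>\<bar> \<le> r $ l" using near by fastforce
    have "\<bar>y $ l - x $ l\<bar> \<le> (r + 1) $ l" for l
    proof -
      have "real_of_int \<lfloor>x $ l\<rfloor> \<le> x $ l" "x $ l \<le> real_of_int \<lfloor>x $ l\<rfloor> + 1" by linarith+
      moreover have "(r + 1) $ l = r $ l + 1" by simp
      ultimately show ?thesis using y(2)[of l] by linarith
    qed
    moreover have "\<forall>l. \<bar>x $ l - x $ l\<bar> \<le> (r + 1) $ l" using r by (simp add: add_nonneg_nonneg)
    ultimately show "x \<in> C \<union> S" using y(1) S(2) unfolding box_frontier_def by blast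
  qed
  then have "measure lebesgue (cells A) \<le> measure lebesgue (C \<union> S)"
    using C measure_cells(1)[OF fin] S(1) by (intro measure_mono_fmeasurable) auto
  also have "\<dots> \<le> measure lebesgue C + measure lebesgue S"
    using C S(1) by (intro measure_Un_le) auto
  finally show ?thesis using measure_cells(2)[OF fin] by simp
qed

section \<open>Blocks and cells of the lattice\<close>

lemma finite_card_vec_Pi:
  fixes S :: "'d::finite \<Rightarrow> 'b set"
  assumes "\<And>l. finite (S l)"
  shows "finite {v :: 'b^'d. \<forall>l. v $ l \<in> S l}" "card {v :: 'b^'d. \<forall>l. v $ l \<in> S l} = (\<Prod>l\<in>UNIV. card (S l))"
proof -
  have eq: "{v :: 'b^'d. \<forall>l. v $ l \<in> S l} = vec_lambda ` (Pi\<^sub>E UNIV S)"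
  proof (intro equalityI subsetI)
    fix v :: "'b^'d" assume "v \<in> {v. \<forall>l. v $ l \<in> S l}"
    then show "v \<in> vec_lambda ` (Pi\<^sub>E UNIV S)" by (intro image_eqI[where x="vec_nth v"]) auto
  qed (auto simp: PiE_iff)
  have inj: "inj_on (vec_lambda :: ('d \<Rightarrow> 'b) \<Rightarrow> 'b^'d) (Pi\<^sub>E UNIV S)"
    by (rule inj_onI) (metis vec_lambda_inverse UNIV_I)
  show "finite {v :: 'b^'d. \<forall>l. v $ l \<in> S l}" unfolding eq using assms by (intro finite_imageI finite_PiE) auto
  show "card {v :: 'b^'d. \<forall>l. v $ l \<in> S l} = (\<Prod>l\<in>UNIV. card (S l))"
    unfolding eq by (simp add: card_image[OF inj] card_PiE)
qed

definition block :: "int^'d::finite \<Rightarrow> (int^'d) set" where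
  "block t = {v. \<forall>l. 0 \<le> v $ l \<and> v $ l < t $ l}"

definition cell :: "int^'d::finite \<Rightarrow> int^'d \<Rightarrow> (int^'d) set" where
  "cell t z = (+) (t * z) ` block t"

text \<open>Written as an order interval so that it qualifies as a box for the mixing condition. A
  site outside \<open>block t\<close> differs from each site of the core by at least
  \<open>g $ l\<close> in some coordinate \<open>l\<close>.\<close>

definition core :: "int^'d::finite \<Rightarrow> int^'d \<Rightarrow> (int^'d) set" where
  "core t g = {g..t - g}"

text \<open>The block with its adjacent cells: a site whose coordinates differ by at most
  \<open>t $ l\<close> from those of a site of the block stays inside.\<close>

definition triple_block :: "int^'d::finite \<Rightarrow> (int^'d) set" where
  "triple_block t = {v. \<forall>l. - t $ l \<le> v $ l \<and> v $ l < 2 * t $ l}"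

lemma finite_card_block: "finite (block t)" "card (block t) = (\<Prod>l\<in>UNIV. nat (t $ l))"
proof -
  have eq: "block t = {v. \<forall>l. v $ l \<in> {0..<t $ l}}" by (auto simp: block_def)
  show "finite (block t)" "card (block t) = (\<Prod>l\<in>UNIV. nat (t $ l))"
    unfolding eq by (subst finite_card_vec_Pi; simp)+
qed

lemma finite_card_triple_block:
  fixes t :: "int^'d::finite"
  assumes "\<And>l. 0 \<le> t $ l"
  shows "finite (triple_block t)" "card (triple_block t) = 3 ^ CARD('d) * card (block t)"
proof -
  have eq: "triple_block t = {v. \<forall>l. v $ l \<in> {- t $ l..<2 * t $ l}}" by (auto simp: triple_block_def)
  show "finite (triple_block t)" unfolding eq by (subst finite_card_vec_Pi; simp)
  have "nat (2 * t $ l + t $ l) = 3 * nat (t $ l)" for l using assms[of l] by linarith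
  then show "card (triple_block t) = 3 ^ CARD('d) * card (block t)"
    unfolding eq by (subst finite_card_vec_Pi; simp add: finite_card_block prod.distrib)
qed

lemma card_core: "card (core t g) = (\<Prod>l\<in>UNIV. nat (t $ l - 2 * g $ l + 1))"
proof -
  have eq: "core t g = {v. \<forall>l. v $ l \<in> {g $ l..t $ l - g $ l}}"
    by (auto simp: core_def less_eq_vec_def)
  show ?thesis unfolding eq by (subst finite_card_vec_Pi; simp add: algebra_simps)
qed

lemma core_subset_block:
  assumes "\<And>l. 0 < g $ l"
  shows "core t g \<subseteq> block t"
proof
  fix v assume "v \<in> core t g"
  then have v: "g $ l \<le> v $ l" "v $ l \<le> t $ l - g $ l" for l by (simp_all add: core_def less_eq_vec_def)
  have "0 \<le> v $ l \<and> v $ l < t $ l" for l using v[of l] assms[of l] by linarith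
  then show "v \<in> block t" by (simp add: block_def)
qed

lemma mem_cell: "v \<in> cell t z \<longleftrightarrow> (\<forall>l. t $ l * z $ l \<le> v $ l \<and> v $ l < t $ l * z $ l + t $ l)"
proof
  assume *: "\<forall>l. t $ l * z $ l \<le> v $ l \<and> v $ l < t $ l * z $ l + t $ l"
  have "0 \<le> v $ l - t $ l * z $ l \<and> v $ l - t $ l * z $ l < t $ l" for l
    using spec[OF *, of l] by (intro conjI) linarith+
  then have "v - t * z \<in> block t"
    by (simp only: block_def mem_Collect_eq vector_minus_component vector_mult_component simp_thms)
  then show "v \<in> cell t z" unfolding cell_def by (rule rev_image_eqI) simp
qed (auto simp: cell_def block_def)

lemma cell_disjoint:
  assumes "v \<in> cell t z" "v \<in> cell t z'"
  shows "z = z'"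
proof -
  have *: "v $ l div t $ l = z $ l" if "v \<in> cell t z" for z l
  proof -
    have "t $ l * z $ l \<le> v $ l" "v $ l < t $ l * z $ l + t $ l" using that by (simp_all add: mem_cell)
    then show ?thesis by (intro int_div_pos_eq[where r="v $ l - t $ l * z $ l"]) linarith+
  qed
  show ?thesis using *[OF assms(1)] *[OF assms(2)] by (simp add: vec_eq_iff)
qed

text \<open>Coordinates of the unit ball are at most 1 in modulus, so the ellipsoidal neighbourhood
  in the separation condition lies in a box with half-sides \<open>\<bar>\<gamma> $ l\<bar>\<close>.
  A site that is closer than \<open>g\<close> to the core in every coordinate is still in the
  cell.\<close>

lemma separated_core:
  assumes \<gamma>: "\<And>l. \<bar>\<gamma> $ l\<bar> < real_of_int (g $ l)" and B: "B \<inter> cell t z = {}"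
  shows "separated \<gamma> ((+) (t * z) ` core t g) B"
  unfolding separated_def
proof (intro subsetI ComplI notI)
  fix y assume y: "y \<in> real_vec ` B" "y \<in> real_vec ` (+) (t * z) ` core t g + (*) \<gamma> ` cball 0 1"
  then obtain b where b: "b \<in> B" "y = real_vec b" by blast
  obtain a u where au: "y = a + u" "a \<in> real_vec ` (+) (t * z) ` core t g" "u \<in> (*) \<gamma> ` cball 0 1"
    using y(2) by (rule set_plus_elim)
  obtain v where a: "a = real_vec v" "v \<in> (+) (t * z) ` core t g" using au(2) by (rule imageE)
  obtain e where u: "u = \<gamma> * e" "e \<in> cball 0 1" using au(3) by (rule imageE)
  have eq: "real_vec b = real_vec v + \<gamma> * e" using b(2) au(1) a(1) u(1) by simp
  have d: "\<bar>b $ l - v $ l\<bar> < g $ l" for l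
  proof -
    have "\<bar>e $ l\<bar> \<le> 1" using u(2) component_le_norm_cart[of e l] by simp
    then have "\<bar>\<gamma> $ l * e $ l\<bar> \<le> \<bar>\<gamma> $ l\<bar>" by (simp add: abs_mult mult_left_le)
    moreover have "real_of_int (b $ l) = real_of_int (v $ l) + \<gamma> $ l * e $ l"
      using arg_cong[OF eq, of "\<lambda>w. w $ l"] by (simp add: real_vec_def)
    ultimately have "real_of_int \<bar>b $ l - v $ l\<bar> < real_of_int (g $ l)" using \<gamma>[of l] by simp
    then show ?thesis by linarith
  qed
  obtain w where w: "v = t * z + w" "w \<in> core t g" using a(2) by blast
  have "t $ l * z $ l \<le> b $ l \<and> b $ l < t $ l * z $ l + t $ l" for l
  proof -
    have "v $ l = t $ l * z $ l + w $ l" "g $ l \<le> w $ l" "w $ l \<le> t $ l - g $ l"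
      using w by (simp_all add: core_def less_eq_vec_def)
    then show ?thesis using d[of l] by linarith
  qed
  then have "b \<in> cell t z" by (simp add: mem_cell)
  then show False using B b(1) by blast
qed

lemma lattice_box_translate: "lattice_box ((+) h ` {a..b})"
proof -
  have "(+) h ` {a..b} = {h + a..h + b}"
  proof (intro equalityI subsetI)
    fix v assume "v \<in> {h + a..h + b}"
    then have "v - h \<in> {a..b}" by (auto simp: less_eq_vec_def algebra_simps)
    then show "v \<in> (+) h ` {a..b}" by (rule rev_image_eqI) simp
  qed (auto simp: less_eq_vec_def)
  then show ?thesis unfolding lattice_box_def by blast
qed

text \<open>Provides the last exceedance among the finitely many sites of a block.\<close>

lemma linear_order_finite_max:
  assumes "linear_order R" "finite S" "S \<noteq> {}"
  shows "\<exists>v\<in>S. \<forall>z\<in>S. (z, v) \<in> R"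
  using assms(2,3)
proof (induction S rule: finite_ne_induct)
  case (singleton a)
  then show ?case using assms(1) by (auto simp: order_on_defs refl_on_def)
next
  case (insert a S)
  then obtain v where v: "v \<in> S" "\<forall>z\<in>S. (z, v) \<in> R" by blast
  have R: "trans R" "refl R" "total R" using assms(1) by (auto simp: order_on_defs)
  show ?case
  proof (cases "(a, v) \<in> R")
    case True
    then show ?thesis using v by blast
  next
    case False
    then have "(v, a) \<in> R" using R v(1) by (metis UNIV_I refl_onD total_on_def)
    then have "\<forall>z\<in>S. (z, a) \<in> R" using v(2) R(1) by (meson transD)
    then show ?thesis using R(2) by (auto simp: refl_on_def)
  qed
qed

text \<open>One step of splitting off a cell: \<open>a\<close>, \<open>a'\<close> and
  \<open>b\<close> stand for the exceedance probabilities of the cell, its core and the remaining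
  cells, \<open>u\<close> and \<open>u'\<close> for those of the remaining cells joined with the
  cell or with the core. Shrinking costs \<open>\<delta>\<close> twice, factorisation costs
  \<open>\<alpha>\<close>, and the earlier error \<open>e\<close> is not amplified because it is
  multiplied by \<open>1 - a\<close>.\<close>

lemma product_perturbation:
  fixes a a' b u u' \<alpha> \<delta> e r :: real
  assumes a: "a \<le> a' + \<delta>" "a' \<le> a" and u: "u \<le> u' + \<delta>" "u' \<le> u"
    and \<alpha>: "\<bar>(1 - u') - (1 - a') * (1 - b)\<bar> \<le> \<alpha>" and r: "\<bar>(1 - b) - r\<bar> \<le> e"
    and "0 \<le> a" "a \<le> 1" "0 \<le> b" "b \<le> 1"
  shows "\<bar>(1 - u) - (1 - a) * r\<bar> \<le> \<alpha> + 2 * \<delta> + e"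
proof -
  have "\<bar>(1 - a') * (1 - b) - (1 - a) * (1 - b)\<bar> = \<bar>a - a'\<bar> * \<bar>1 - b\<bar>"
    unfolding left_diff_distrib[symmetric] abs_mult by simp
  also have "\<dots> \<le> \<delta> * 1" using assms by (intro mult_mono) auto
  finally have 1: "\<bar>(1 - a') * (1 - b) - (1 - a) * (1 - b)\<bar> \<le> \<delta>" by simp
  have "\<bar>(1 - a) * (1 - b) - (1 - a) * r\<bar> = \<bar>1 - a\<bar> * \<bar>(1 - b) - r\<bar>"
    unfolding right_diff_distrib[symmetric] abs_mult by simp
  also have "\<dots> \<le> 1 * e" using assms by (intro mult_mono) auto
  finally have 2: "\<bar>(1 - a) * (1 - b) - (1 - a) * r\<bar> \<le> e" by simp
  show ?thesis using 1 2 u \<alpha> by linarith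
qed

text \<open>Integer counterpart of \<open>successors\<close>, convenient for translating by lattice
  vectors.\<close>

definition later :: "((int^'d) \<times> (int^'d)) set \<Rightarrow> int^'d \<Rightarrow> int^'d \<Rightarrow> (int^'d) set" where
  "later R t v = {z. (\<forall>l. \<bar>z $ l - v $ l\<bar> \<le> t $ l) \<and> (v, z) \<in> R \<and> v \<noteq> z}"

section \<open>Exceedances of a stationary field\<close>

locale stationary_field = prob_space M for M :: "'a measure" +
  fixes \<xi> :: "int^'d::finite \<Rightarrow> 'a \<Rightarrow> real"
  assumes random_field: "random_field M \<xi>" and stationary: "stationary M \<xi>"
begin

text \<open>The complement of the event that the maximum is at most \<open>x\<close>; unions of
  index sets become unions of events.\<close>

definition hit :: "real \<Rightarrow> (int^'d) set \<Rightarrow> 'a set" where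
  "hit x A = {\<omega> \<in> space M. \<exists>v\<in>A. x < \<xi> v \<omega>}"

lemma measurable_field [measurable]: "\<xi> v \<in> borel_measurable M"
  using random_field by (simp add: random_field_def)

lemma hit_UN: "hit x A = (\<Union>v\<in>A. hit x {v})"
  by (auto simp: hit_def)

lemma sets_hit [measurable, simp]: "hit x A \<in> events"
proof -
  have "hit x {v} \<in> events" for v unfolding hit_def by simp
  then show ?thesis by (subst hit_UN) (intro sets.countable_UN'' countableI_type)
qed

lemma hit_Un: "hit x (A \<union> B) = hit x A \<union> hit x B"
  by (auto simp: hit_def)

lemma hit_mono: "A \<subseteq> B \<Longrightarrow> hit x A \<subseteq> hit x B"
  by (auto simp: hit_def)

lemma prob_field_max_le: "\<P>(\<omega> in M. field_max \<xi> A \<omega> \<le> ereal x) = 1 - prob (hit x A)"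
proof -
  have "{\<omega> \<in> space M. field_max \<xi> A \<omega> \<le> ereal x} = space M - hit x A"
    by (auto simp: field_max_def SUP_le_iff hit_def not_less)
  then show ?thesis using prob_compl[OF sets_hit] by simp
qed

text \<open>Stationarity equates the laws of the shifted and the unshifted field on the product
  space. The event is the preimage of a set \<open>S\<close> there, which is measurable as a
  countable union of conditions on single coordinates.\<close>

lemma prob_hit_translate: "prob (hit x ((+) h ` A)) = prob (hit x A)"
proof -
  let ?N = "Pi\<^sub>M UNIV (\<lambda>_::int^'d. borel :: real measure)"
  define S where "S = {f \<in> space ?N. \<exists>v\<in>A. x < f v}"
  have S: "S \<in> sets ?N"
  proof -
    have "S = (\<Union>v\<in>A. {f \<in> space ?N. x < f v})" by (auto simp: S_def)
    also have "\<dots> \<in> sets ?N"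
    proof (intro sets.countable_UN'' countableI_type)
      fix v
      have "(\<lambda>f. f v) \<in> borel_measurable ?N" by (rule measurable_component_singleton) simp
      then show "{f \<in> space ?N. x < f v} \<in> sets ?N" by measurable
    qed
    finally show ?thesis .
  qed
  have meas: "(\<lambda>\<omega> v. \<xi> (v + h) \<omega>) \<in> measurable M ?N" for h
    by (rule measurable_PiM_single') auto
  have vim: "(\<lambda>\<omega> v. \<xi> (v + h) \<omega>) -` S \<inter> space M = hit x ((+) h ` A)" for h
    by (auto simp: S_def hit_def space_PiM add.commute)
  have "measure (distr M ?N (\<lambda>\<omega> v. \<xi> (v + h) \<omega>)) S = prob (hit x ((+) h ` A))" for h
    using measure_distr[OF meas S, of h] vim[of h] by simp
  from this[of h] this[of 0] show ?thesis
    using stationary unfolding stationary_def by simp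
qed

lemma prob_hit_single: "prob (hit x {v}) = prob (hit x {0})"
  using prob_hit_translate[of x v "{0}"] by simp

lemma prob_hit_le:
  assumes "finite A"
  shows "prob (hit x A) \<le> card A * prob (hit x {0})"
proof -
  have "prob (hit x A) = prob (\<Union>v\<in>A. hit x {v})" by (subst hit_UN) simp
  also have "\<dots> \<le> (\<Sum>v\<in>A. prob (hit x {v}))" using assms by (intro finite_measure_subadditive_finite) auto
  also have "\<dots> = (\<Sum>v\<in>A. prob (hit x {0}))" by (rule sum.cong[OF refl prob_hit_single])
  also have "\<dots> = card A * prob (hit x {0})" by simp
  finally show ?thesis .
qed

lemma prob_hit_mono: "A \<subseteq> B \<Longrightarrow> prob (hit x A) \<le> prob (hit x B)"
  by (intro finite_measure_mono hit_mono) auto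

lemma prob_hit_Un_le: "prob (hit x (A \<union> B)) \<le> prob (hit x A) + prob (hit x B)"
  unfolding hit_Un by (rule measure_Un_le) auto

lemma prob_hit_subset_le:
  assumes "A \<subseteq> B" "finite B"
  shows "prob (hit x B) \<le> prob (hit x A) + card (B - A) * prob (hit x {0})"
proof -
  have "prob (hit x B) \<le> prob (hit x A) + prob (hit x (B - A))"
    using prob_hit_Un_le[of x A "B - A"] assms(1) by (simp add: Un_absorb1)
  also have "\<dots> \<le> prob (hit x A) + card (B - A) * prob (hit x {0})"
    using assms by (intro add_left_mono prob_hit_le) auto
  finally show ?thesis .
qed

section \<open>Mixing across cells and within a block\<close>

text \<open>The mixing condition at a single index, restated for exceedance events with the first
  set as the box; in the applications this set is a core.\<close>

definition mixes :: "real \<Rightarrow> (int^'d) set \<Rightarrow> real \<Rightarrow> real^'d \<Rightarrow> bool" where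
  "mixes x K \<alpha> \<gamma> \<longleftrightarrow> (\<forall>A B. A \<subseteq> K \<longrightarrow> B \<subseteq> K \<longrightarrow> separated \<gamma> A B \<longrightarrow> lattice_box A \<longrightarrow>
     \<bar>(1 - prob (hit x (A \<union> B))) - (1 - prob (hit x A)) * (1 - prob (hit x B))\<bar> \<le> \<alpha>)"

lemma mixes_if_mixing_condition:
  assumes "mixing_condition M \<xi> c x K \<alpha> \<gamma>"
  shows "mixes (x n) (K n) (\<alpha> n) (\<gamma> n)"
  unfolding mixes_def
proof (intro allI impI)
  fix A B assume "A \<subseteq> K n" "B \<subseteq> K n" "separated (\<gamma> n) A B" "lattice_box A"
  with assms show "\<bar>(1 - prob (hit (x n) (A \<union> B))) - (1 - prob (hit (x n) A)) * (1 - prob (hit (x n) B))\<bar> \<le> \<alpha> n"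
    unfolding mixing_condition_def prob_field_max_le by meson
qed

text \<open>The margin \<open>g\<close> strictly exceeds \<open>\<bar>\<gamma>\<bar>\<close>, which
  makes the core both a part of the cell and separated from everything outside the cell.\<close>

lemma mixes_core:
  assumes mix: "mixes x K \<alpha> \<gamma>" and \<gamma>: "\<And>l. \<bar>\<gamma> $ l\<bar> < real_of_int (g $ l)"
    and B: "B \<inter> cell t z = {}" "B \<subseteq> K" and cellK: "cell t z \<subseteq> K"
  defines "J \<equiv> (+) (t * z) ` core t g"
  shows "\<bar>(1 - prob (hit x (J \<union> B))) - (1 - prob (hit x J)) * (1 - prob (hit x B))\<bar> \<le> \<alpha>"
proof -
  have "0 < g $ l" for l using order_le_less_trans[OF abs_ge_zero \<gamma>[of l]] by simp
  then have "J \<subseteq> cell t z" unfolding J_def cell_def by (intro image_mono core_subset_block)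
  then have "J \<subseteq> K" using cellK by blast
  moreover have "separated \<gamma> J B" unfolding J_def by (rule separated_core[OF \<gamma> B(1)])
  moreover have "lattice_box J" unfolding J_def core_def by (rule lattice_box_translate)
  ultimately show ?thesis using mix B(2) unfolding mixes_def by blast
qed

text \<open>Induction over the cells. Only the new cell is shrunk: its core is separated from the
  remaining full cells, so mixing splits it off, and by stationarity the new cell contributes the
  same factor as \<open>block t\<close>. Each cell costs
  \<open>\<alpha> + 2 * \<delta>\<close>.\<close>

lemma prob_hit_cells_approx:
  fixes \<delta> :: real
  assumes mix: "mixes x K \<alpha> \<gamma>" and \<gamma>: "\<And>l. \<bar>\<gamma> $ l\<bar> < real_of_int (g $ l)"
    and "finite Z" and "\<And>z. z \<in> Z \<Longrightarrow> cell t z \<subseteq> K"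
  defines "(\<delta>::real) \<equiv> card (block t - core t g) * prob (hit x {0})"
  shows "\<bar>(1 - prob (hit x (\<Union>z\<in>Z. cell t z))) - (1 - prob (hit x (block t))) ^ card Z\<bar>
    \<le> card Z * (\<alpha> + 2 * \<delta>)"
  using assms(3,4)
proof (induction Z rule: finite_induct)
  case empty
  then show ?case by (simp add: hit_def)
next
  case (insert z Z)
  define B where "B = (\<Union>z\<in>Z. cell t z)"
  define J where "J = cell t z"
  define J' where "J' = (+) (t * z) ` core t g"
  have g: "0 < g $ l" for l using order_le_less_trans[OF abs_ge_zero \<gamma>[of l]] by simp
  have fJ: "finite J" unfolding J_def cell_def by (simp add: finite_card_block)
  have J'J: "J' \<subseteq> J" unfolding J'_def J_def cell_def using g by (intro image_mono core_subset_block)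
  have "J - J' = (+) (t * z) ` (block t - core t g)"
    unfolding J'_def J_def cell_def by (rule image_set_diff[symmetric]) simp
  then have "card (J - J') = card (block t - core t g)" by (simp add: card_image)
  then have \<delta>: "card (J - J') * prob (hit x {0}) = \<delta>" by (simp add: \<delta>_def)
  have 1: "prob (hit x J) \<le> prob (hit x J') + \<delta>" "prob (hit x J') \<le> prob (hit x J)"
    using prob_hit_subset_le[OF J'J fJ, of x] prob_hit_mono[OF J'J] unfolding \<delta> by auto
  have 2: "prob (hit x (J \<union> B)) \<le> prob (hit x (J' \<union> B)) + \<delta>" "prob (hit x (J' \<union> B)) \<le> prob (hit x (J \<union> B))"
  proof -
    have "prob (hit x (J \<union> B)) \<le> prob (hit x ((J' \<union> B) \<union> (J - J')))" by (rule prob_hit_mono) blast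
    also have "\<dots> \<le> prob (hit x (J' \<union> B)) + prob (hit x (J - J'))" by (rule prob_hit_Un_le)
    also have "prob (hit x (J - J')) \<le> \<delta>" using prob_hit_le[of "J - J'" x] fJ unfolding \<delta> by simp
    finally show "prob (hit x (J \<union> B)) \<le> prob (hit x (J' \<union> B)) + \<delta>" by simp
    show "prob (hit x (J' \<union> B)) \<le> prob (hit x (J \<union> B))" using J'J by (intro prob_hit_mono) blast
  qed
  have Bd: "B \<inter> cell t z = {}" using insert.hyps cell_disjoint[of _ t z] unfolding B_def by blast
  have BK: "B \<subseteq> K" and zK: "cell t z \<subseteq> K" using insert.prems unfolding B_def by auto
  have 3: "\<bar>(1 - prob (hit x (J' \<union> B))) - (1 - prob (hit x J')) * (1 - prob (hit x B))\<bar> \<le> \<alpha>"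
    unfolding J'_def by (rule mixes_core[OF mix \<gamma> Bd BK zK])
  have 4: "prob (hit x J) = prob (hit x (block t))" unfolding J_def cell_def by (rule prob_hit_translate)
  have 5: "\<bar>(1 - prob (hit x B)) - (1 - prob (hit x (block t))) ^ card Z\<bar> \<le> card Z * (\<alpha> + 2 * \<delta>)"
    unfolding B_def using insert.IH insert.prems by simp
  have "\<bar>(1 - prob (hit x (J \<union> B))) - (1 - prob (hit x J)) * (1 - prob (hit x (block t))) ^ card Z\<bar>
      \<le> \<alpha> + 2 * \<delta> + card Z * (\<alpha> + 2 * \<delta>)"
    using product_perturbation[OF 1 2 3 5] by simp
  then have "\<bar>(1 - prob (hit x (J \<union> B))) - (1 - prob (hit x (block t))) * (1 - prob (hit x (block t))) ^ card Z\<bar>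
      \<le> (real (card Z) + 1) * (\<alpha> + 2 * \<delta>)"
    unfolding 4 by (simp only: distrib_right mult_1 add.commute)
  moreover have "(\<Union>z\<in>insert z Z. cell t z) = J \<union> B" unfolding J_def B_def by blast
  moreover have "real (card (insert z Z)) = real (card Z) + 1" "card (insert z Z) = Suc (card Z)"
    using insert.hyps by simp_all
  ultimately show ?case by (simp only: power_Suc)
qed

text \<open>Split the event of an exceedance in the block according to the last exceedance with respect to
  the order; the neighbourhood of that site may leave the block, which costs a joint exceedance in
  two asymptotically independent regions.\<close>

lemma prob_hit_block_approx:
  fixes p :: real
  assumes mix: "mixes x K \<alpha> \<gamma>" and \<gamma>: "\<And>l. \<bar>\<gamma> $ l\<bar> < real_of_int (g $ l)"
    and t: "\<And>l. 0 < t $ l" and K: "triple_block t \<subseteq> K"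
    and R: "linear_order R" "translation_invariant R"
  defines "p \<equiv> prob (hit x {0})"
  shows "\<bar>prob (hit x (block t)) - card (block t) * prob (hit x {0} - hit x (later R t 0))\<bar>
    \<le> \<alpha> + card (block t - core t g) * p + 3 ^ CARD('d) * (card (block t) * p)\<^sup>2"
proof -
  define J where "J = block t"
  define B where "B = triple_block t - J"
  \<comment> \<open>Candidates for the last exceedance: only the neighbourhood of \<open>v\<close>
    is examined instead of the whole block, so that all these events have the same
    probability.\<close>
  define F where "F v = hit x {v} - hit x (later R t v)" for v
  have total: "(v, w) \<in> R \<or> (w, v) \<in> R" for v w
    using R(1) unfolding order_on_defs refl_on_def total_on_def by (cases "v = w") blast+
  have antisym: "(v, w) \<in> R \<Longrightarrow> (w, v) \<in> R \<Longrightarrow> v = w" for v w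
    using R(1) unfolding order_on_defs antisym_def by blast
  have fJ: "finite J" by (simp add: J_def finite_card_block)
  have ft: "finite (triple_block t)" using t by (intro finite_card_triple_block less_imp_le)
  have J3: "J \<subseteq> triple_block t"
  proof
    fix v assume "v \<in> J"
    then have v: "0 \<le> v $ l" "v $ l < t $ l" for l by (simp_all add: J_def block_def)
    have "- t $ l \<le> v $ l \<and> v $ l < 2 * t $ l" for l using v[of l] t[of l] by linarith
    then show "v \<in> triple_block t" by (simp add: triple_block_def)
  qed
  have PF: "prob (F v) = prob (F 0)" for v
  proof -
    have later: "later R t v = (+) v ` later R t 0"
    proof (intro equalityI subsetI)
      fix z assume z: "z \<in> later R t v"
      have "(0 + v, (z - v) + v) \<in> R \<longleftrightarrow> (0, z - v) \<in> R"
        using R(2) unfolding translation_invariant_def by blast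
      then have "z - v \<in> later R t 0" using z by (auto simp: later_def)
      then show "z \<in> (+) v ` later R t 0" by (rule rev_image_eqI) simp
    next
      fix z assume "z \<in> (+) v ` later R t 0"
      then obtain w where w: "z = v + w" "w \<in> later R t 0" by blast
      have "(0 + v, w + v) \<in> R \<longleftrightarrow> (0, w) \<in> R"
        using R(2) unfolding translation_invariant_def by blast
      then show "z \<in> later R t v" using w by (auto simp: later_def add.commute)
    qed
    \<comment> \<open>As a difference of nested exceedance events, \<open>F v\<close> gets a
      probability expressed by terms that are invariant under translation.\<close>
    have "prob (F v) = prob (hit x (insert v (later R t v))) - prob (hit x (later R t v))" for v
    proof -
      have "F v = hit x (insert v (later R t v)) - hit x (later R t v)" by (auto simp: F_def hit_def)
      then show ?thesis by (simp add: finite_measure_Diff hit_mono subset_insertI)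
    qed
    from this[of v] this[of 0] show ?thesis
      using prob_hit_translate[of x v "later R t 0"] prob_hit_translate[of x v "insert 0 (later R t 0)"]
      by (simp add: later)
  qed
  have FE: "F v \<in> events" for v by (simp add: F_def)
  have close: "w \<in> later R t v" if "v \<in> J" "w \<in> J" "(v, w) \<in> R" "v \<noteq> w" for v w
  proof -
    have vw: "0 \<le> v $ l" "v $ l < t $ l" "0 \<le> w $ l" "w $ l < t $ l" for l
      using that(1,2) by (simp_all add: J_def block_def)
    have "\<bar>w $ l - v $ l\<bar> \<le> t $ l" for l using vw[of l] by linarith
    then show ?thesis using that(3,4) by (simp add: later_def)
  qed
  \<comment> \<open>Coordinates of two sites of the block differ by less than \<open>t\<close>, so
    the later site lies in the neighbourhood of the earlier one and the two cannot both be
    last.\<close>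
  have "disjoint_family_on F J"
    unfolding disjoint_family_on_def
  proof (intro ballI impI)
    fix v w assume "v \<in> J" "w \<in> J" "v \<noteq> w"
    then have "w \<in> later R t v \<or> v \<in> later R t w" using total[of v w] close by metis
    then show "F v \<inter> F w = {}" by (auto simp: F_def hit_def)
  qed
  then have "prob (\<Union>v\<in>J. F v) = (\<Sum>v\<in>J. prob (F v))"
    using fJ FE by (intro finite_measure_finite_Union) auto
  also have "\<dots> = (\<Sum>v\<in>J. prob (F 0))" by (rule sum.cong[OF refl PF])
  finally have sumF: "prob (\<Union>v\<in>J. F v) = card J * prob (F 0)" by simp
  have FU: "(\<Union>v\<in>J. F v) \<in> events" using FE fJ by blast
  have sub: "(\<Union>v\<in>J. F v) \<subseteq> hit x J" by (auto simp: F_def hit_def)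
  \<comment> \<open>If the block is hit but no \<open>F v\<close> occurs, the last exceedance
    \<open>v\<close> in the block has a later exceedance in its neighbourhood. By maximality of
    \<open>v\<close> this one lies outside the block, hence in the surrounding ring
    \<open>B\<close>.\<close>
  have "hit x J - (\<Union>v\<in>J. F v) \<subseteq> hit x J \<inter> hit x B"
  proof
    fix \<omega> assume \<omega>: "\<omega> \<in> hit x J - (\<Union>v\<in>J. F v)"
    define S where "S = {v \<in> J. x < \<xi> v \<omega>}"
    have "finite S" "S \<noteq> {}" using fJ \<omega> by (auto simp: S_def hit_def)
    then obtain v where v: "v \<in> S" "\<forall>z\<in>S. (z, v) \<in> R" using linear_order_finite_max[OF R(1)] by blast
    have "\<omega> \<notin> F v" using v(1) \<omega> by (auto simp: S_def)
    then obtain z where z: "z \<in> later R t v" "x < \<xi> z \<omega>" using v(1) \<omega> by (auto simp: F_def S_def hit_def)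
    have "z \<notin> J"
    proof
      assume "z \<in> J"
      then have "(z, v) \<in> R" using v(2) z(2) by (auto simp: S_def)
      then show False using z(1) antisym by (auto simp: later_def)
    qed
    moreover have "z \<in> triple_block t"
    proof -
      have "- t $ l \<le> z $ l \<and> z $ l < 2 * t $ l" for l
      proof -
        have "\<bar>z $ l - v $ l\<bar> \<le> t $ l" "0 \<le> v $ l" "v $ l < t $ l"
          using v(1) z(1) by (auto simp: S_def J_def block_def later_def)
        then show ?thesis by linarith
      qed
      then show ?thesis by (simp add: triple_block_def)
    qed
    ultimately show "\<omega> \<in> hit x J \<inter> hit x B" using \<omega> z(2) by (auto simp: B_def hit_def)
  qed
  then have "prob (hit x J - (\<Union>v\<in>J. F v)) \<le> prob (hit x J \<inter> hit x B)"
    by (intro finite_measure_mono) auto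
  then have main: "prob (hit x J) - card J * prob (F 0) \<le> prob (hit x J \<inter> hit x B)"
    and nonneg: "0 \<le> prob (hit x J) - card J * prob (F 0)"
    using finite_measure_Diff[OF sets_hit FU sub] finite_measure_mono[OF sub] sumF by auto
  define J' where "J' = core t g"
  have g: "0 < g $ l" for l using order_le_less_trans[OF abs_ge_zero \<gamma>[of l]] by simp
  have J'J: "J' \<subseteq> J" unfolding J'_def J_def using g by (rule core_subset_block)
  \<comment> \<open>Mixing concerns non-exceedances; by inclusion and exclusion the same error
    bounds the covariance of the two exceedance events.\<close>
  have cov: "prob (hit x J' \<inter> hit x B) \<le> prob (hit x J') * prob (hit x B) + \<alpha>"
  proof -
    have c0: "cell t 0 = J" "(+) (t * 0) ` core t g = J'" by (auto simp: cell_def J_def J'_def)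
    have "\<bar>(1 - prob (hit x (J' \<union> B))) - (1 - prob (hit x J')) * (1 - prob (hit x B))\<bar> \<le> \<alpha>"
      using mixes_core[OF mix \<gamma>, of B t 0] K J3 unfolding c0 B_def by auto
    moreover have "prob (hit x (J' \<union> B)) = prob (hit x J') + prob (hit x B) - prob (hit x J' \<inter> hit x B)"
      unfolding hit_Un by (rule measure_Un3) (auto simp: fmeasurable_eq_sets)
    ultimately show ?thesis by (simp add: algebra_simps)
  qed
  have "hit x J \<inter> hit x B \<subseteq> (hit x J' \<inter> hit x B) \<union> hit x (J - J')" by (auto simp: hit_def)
  then have "prob (hit x J \<inter> hit x B) \<le> prob ((hit x J' \<inter> hit x B) \<union> hit x (J - J'))"
    by (intro finite_measure_mono) auto
  also have "\<dots> \<le> prob (hit x J' \<inter> hit x B) + prob (hit x (J - J'))" by (rule measure_Un_le) auto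
  also have "prob (hit x (J - J')) \<le> card (J - J') * p" unfolding p_def using fJ by (intro prob_hit_le) auto
  \<comment> \<open>The ring is part of the triple block, whose size gives the factor
    \<open>3 ^ CARD('d)\<close>. The product is thus quadratic in the expected number of exceedances
    in a block.\<close>
  also have "prob (hit x J') * prob (hit x B) \<le> (card J * p) * (3 ^ CARD('d) * card J * p)"
  proof (rule mult_mono)
    have "prob (hit x J') \<le> prob (hit x J)" by (rule prob_hit_mono[OF J'J])
    also have "\<dots> \<le> card J * p" unfolding p_def using fJ by (rule prob_hit_le)
    finally show "prob (hit x J') \<le> card J * p" .
    have "prob (hit x B) \<le> prob (hit x (triple_block t))" by (rule prob_hit_mono) (simp add: B_def)
    also have "\<dots> \<le> card (triple_block t) * p" unfolding p_def using ft by (rule prob_hit_le)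
    also have "card (triple_block t) = 3 ^ CARD('d) * card J"
      unfolding J_def using t by (intro finite_card_triple_block less_imp_le)
    finally show "prob (hit x B) \<le> 3 ^ CARD('d) * card J * p" by simp
  qed (auto simp: p_def)
  note * = this
  have "prob (hit x J \<inter> hit x B) \<le> (card J * p) * (3 ^ CARD('d) * card J * p) + \<alpha> + card (J - J') * p"
    using calculation cov * by linarith
  then have "\<bar>prob (hit x J) - card J * prob (F 0)\<bar> \<le> (card J * p) * (3 ^ CARD('d) * card J * p) + \<alpha> + card (J - J') * p"
    using main nonneg by linarith
  then show ?thesis by (simp add: J_def J'_def F_def power2_eq_square algebra_simps)
qed

end

section \<open>Cells meeting a set\<close>

definition int_sides :: "real^'d::finite \<Rightarrow> nat \<Rightarrow> int^'d" where
  "int_sides c k = (\<chi> l. \<lfloor>c $ l / root CARD('d) (real k)\<rfloor>)"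

lemma side_lengths_eq: "side_lengths c k = real_vec (int_sides c k)"
  by (simp add: side_lengths_def real_vec_def int_sides_def)

lemma mem_real_cell:
  fixes c :: "real^'d::finite"
  assumes t: "\<And>l. 0 < int_sides c k $ l"
  defines "t \<equiv> int_sides c k"
  shows "y \<in> real_cell c k z \<longleftrightarrow> (\<forall>l. real_of_int (t $ l * z $ l) \<le> y $ l \<and> y $ l < real_of_int (t $ l * z $ l + t $ l))"
proof
  assume "y \<in> real_cell c k z"
  then obtain u where u: "u \<in> unit_cell" and y: "y = real_vec t * (real_vec z + u)"
    by (auto simp: real_cell_def side_lengths_eq t_def)
  show "\<forall>l. real_of_int (t $ l * z $ l) \<le> y $ l \<and> y $ l < real_of_int (t $ l * z $ l + t $ l)"
  proof
    fix l
    have "0 \<le> u $ l" "u $ l < 1" using u by (auto simp: unit_cell_def)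
    then have "0 \<le> real_of_int (t $ l) * u $ l" "real_of_int (t $ l) * u $ l < real_of_int (t $ l)"
      using t[of l] by (auto simp: t_def)
    then show "real_of_int (t $ l * z $ l) \<le> y $ l \<and> y $ l < real_of_int (t $ l * z $ l + t $ l)"
      by (simp add: y real_vec_def distrib_left)
  qed
next
  assume y: "\<forall>l. real_of_int (t $ l * z $ l) \<le> y $ l \<and> y $ l < real_of_int (t $ l * z $ l + t $ l)"
  define u :: "real^'d" where "u = (\<chi> l. y $ l / real_of_int (t $ l) - real_of_int (z $ l))"
  have "0 \<le> u $ l \<and> u $ l < 1" for l
    using spec[OF y, of l] t[of l] by (auto simp: u_def t_def field_simps)
  then have "u \<in> unit_cell" by (simp add: unit_cell_def)
  moreover have "t $ l \<noteq> 0" for l using t[of l] by (simp add: t_def)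
  then have "y = real_vec t * (real_vec z + u)"
    by (simp add: vec_eq_iff real_vec_def u_def)
  ultimately show "y \<in> real_cell c k z"
    unfolding real_cell_def side_lengths_eq t_def[symmetric] by blast
qed

lemma lattice_cell_eq:
  assumes "\<And>l. 0 < int_sides c k $ l"
  shows "lattice_cell c k z = cell (int_sides c k) z"
proof -
  have "v \<in> lattice_cell c k z \<longleftrightarrow> v \<in> cell (int_sides c k) z" for v
    unfolding lattice_cell_def lattice_points_def mem_Collect_eq mem_real_cell[OF assms] mem_cell real_vec_def
    by (simp only: vec_lambda_beta of_int_le_iff of_int_less_iff)
  then show ?thesis by blast
qed

lemma successors_eq:
  fixes c :: "real^'d::finite"
  assumes t: "\<And>l. 0 < int_sides c k $ l"
  shows "successors R c k v = later R (int_sides c k) v"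
proof -
  define t where "t = int_sides c k"
  have "real_vec z \<in> (+) (real_vec v) ` (*) (real_vec t) ` cube 1 \<longleftrightarrow> (\<forall>l. \<bar>z $ l - v $ l\<bar> \<le> t $ l)" for z
  proof
    assume "real_vec z \<in> (+) (real_vec v) ` (*) (real_vec t) ` cube 1"
    then obtain u where u: "u \<in> cube 1" and eq: "real_vec z = real_vec v + real_vec t * u" by blast
    show "\<forall>l. \<bar>z $ l - v $ l\<bar> \<le> t $ l"
    proof
      fix l
      have "- 1 \<le> u $ l \<and> u $ l \<le> 1" using u by (simp add: cube_def)
      then have "\<bar>u $ l\<bar> \<le> 1" by linarith
      then have "\<bar>real_of_int (t $ l) * u $ l\<bar> \<le> real_of_int (t $ l)"
        using t[of l] by (simp add: abs_mult t_def mult_left_le)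
      moreover have "real_of_int (z $ l) = real_of_int (v $ l) + real_of_int (t $ l) * u $ l"
        using arg_cong[OF eq, of "\<lambda>w. w $ l"] by (simp add: real_vec_def)
      ultimately have "real_of_int \<bar>z $ l - v $ l\<bar> \<le> real_of_int (t $ l)" by simp
      then show "\<bar>z $ l - v $ l\<bar> \<le> t $ l" by linarith
    qed
  next
    assume *: "\<forall>l. \<bar>z $ l - v $ l\<bar> \<le> t $ l"
    define u :: "real^'d" where "u = (\<chi> l. real_of_int (z $ l - v $ l) / real_of_int (t $ l))"
    have "\<bar>u $ l\<bar> \<le> 1" for l
    proof -
      have "\<bar>real_of_int (z $ l - v $ l)\<bar> \<le> real_of_int (t $ l)" using spec[OF *, of l] by linarith
      then show ?thesis using t[of l] by (simp add: u_def t_def abs_divide)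
    qed
    then have "u \<in> cube 1" by (simp add: cube_def abs_le_iff minus_le_iff)
    moreover have "t $ l \<noteq> 0" for l using t[of l] by (simp add: t_def)
    then have "real_vec z = real_vec v + real_vec t * u" by (simp add: vec_eq_iff real_vec_def u_def)
    ultimately show "real_vec z \<in> (+) (real_vec v) ` (*) (real_vec t) ` cube 1" by blast
  qed
  then show ?thesis
    unfolding successors_def later_def lattice_points_def side_lengths_eq t_def by (simp only: mem_Collect_eq conj_assoc)
qed

lemma mem_scaled_cube:
  fixes c :: "real^'d::finite"
  assumes "\<And>l. 0 < c $ l"
  shows "y \<in> (*) c ` cube b \<longleftrightarrow> (\<forall>l. \<bar>y $ l\<bar> \<le> b * c $ l)"
proof
  assume "y \<in> (*) c ` cube b"
  then obtain u where u: "u \<in> cube b" "y = c * u" by blast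
  have "- b \<le> u $ l \<and> u $ l \<le> b" for l using u(1) by (simp add: cube_def)
  then have "\<bar>u $ l\<bar> \<le> b" for l by (simp add: abs_le_iff minus_le_iff)
  then show "\<forall>l. \<bar>y $ l\<bar> \<le> b * c $ l" using assms
    by (simp add: u(2) abs_mult less_imp_le mult.commute[of _ b] mult_right_mono mult.commute[of "c $ _"])
next
  assume y: "\<forall>l. \<bar>y $ l\<bar> \<le> b * c $ l"
  define u :: "real^'d" where "u = (\<chi> l. y $ l / c $ l)"
  have "\<bar>u $ l\<bar> \<le> b" for l using spec[OF y, of l] assms[of l] by (simp add: u_def abs_divide pos_divide_le_eq)
  then have "u \<in> cube b" by (simp add: cube_def abs_le_iff minus_le_iff)
  moreover have "c $ l \<noteq> 0" for l using assms[of l] by simp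
  then have "y = c * u" by (simp add: vec_eq_iff u_def)
  ultimately show "y \<in> (*) c ` cube b" by blast
qed

lemma mem_window:
  assumes "\<And>l. 0 < c $ l"
  shows "v \<in> window c \<kappa> \<longleftrightarrow> (\<forall>l. \<bar>real_of_int (v $ l)\<bar> \<le> \<kappa> * c $ l)"
  unfolding window_def lattice_points_def using mem_scaled_cube[OF assms, where y="real_vec v"]
  by (simp add: real_vec_def)

lemma finite_window:
  fixes c :: "real^'d::finite"
  assumes "\<And>l. 0 < c $ l"
  shows "finite (window c \<kappa>)"
proof (rule finite_subset)
  show "window c \<kappa> \<subseteq> {v. \<forall>l. v $ l \<in> {- \<lceil>\<kappa> * c $ l\<rceil>..\<lceil>\<kappa> * c $ l\<rceil>}}"
  proof
    fix v assume "v \<in> window c \<kappa>"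
    then have v: "\<bar>real_of_int (v $ l)\<bar> \<le> \<kappa> * c $ l" for l by (simp add: mem_window[OF assms])
    have "- \<lceil>\<kappa> * c $ l\<rceil> \<le> v $ l \<and> v $ l \<le> \<lceil>\<kappa> * c $ l\<rceil>" for l using v[of l] by linarith
    then show "v \<in> {v. \<forall>l. v $ l \<in> {- \<lceil>\<kappa> * c $ l\<rceil>..\<lceil>\<kappa> * c $ l\<rceil>}}" by simp
  qed
  show "finite {v::int^'d. \<forall>l. v $ l \<in> {- \<lceil>\<kappa> * c $ l\<rceil>..\<lceil>\<kappa> * c $ l\<rceil>}}" by (rule finite_card_vec_Pi) simp
qed

lemma outer_cells_properties:
  fixes c :: "real^'d::finite"
  assumes t: "\<And>l. 0 < int_sides c k $ l" and fin: "finite (outer_cells c C k)"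
  defines "t \<equiv> int_sides c k" and "Z \<equiv> {z. real_cell c k z \<inter> C \<noteq> {}}"
  shows "outer_cells c C k = (\<Union>z\<in>Z. cell t z)" "finite Z"
    "card (outer_cells c C k) = card Z * card (block t)"
    "lattice_points C \<subseteq> outer_cells c C k"
    "\<And>v. v \<in> outer_cells c C k \<Longrightarrow> \<exists>y\<in>C. \<forall>l. \<bar>y $ l - real_of_int (v $ l)\<bar> \<le> real_vec t $ l"
proof -
  show eq: "outer_cells c C k = (\<Union>z\<in>Z. cell t z)"
    unfolding outer_cells_def Z_def t_def lattice_cell_eq[OF t] by blast
  \<comment> \<open>Each cell contains its lower corner, so the corners embed \<open>Z\<close> into
    the finite union of the cells.\<close>
  have corner: "t * z \<in> cell t z" for z using t by (simp add: mem_cell t_def)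
  have inj: "inj_on (\<lambda>z. t * z) Z"
  proof (rule inj_onI)
    fix z z' assume "t * z = t * z'"
    then have "t * z \<in> cell t z'" using corner[of z'] by simp
    then show "z = z'" by (rule cell_disjoint[OF corner])
  qed
  have "(\<lambda>z. t * z) ` Z \<subseteq> outer_cells c C k" unfolding eq using corner by blast
  then show finZ: "finite Z" using fin inj by (meson finite_imageD finite_subset)
  have "card (\<Union>z\<in>Z. cell t z) = (\<Sum>z\<in>Z. card (cell t z))"
  proof (rule card_UN_disjoint[OF finZ])
    show "\<forall>z\<in>Z. finite (cell t z)" by (simp add: cell_def finite_card_block)
    show "\<forall>i\<in>Z. \<forall>j\<in>Z. i \<noteq> j \<longrightarrow> cell t i \<inter> cell t j = {}" using cell_disjoint by blast
  qed
  then show "card (outer_cells c C k) = card Z * card (block t)"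
    unfolding eq by (simp add: cell_def card_image)
  show "lattice_points C \<subseteq> outer_cells c C k"
  proof
    fix v assume v: "v \<in> lattice_points C"
    \<comment> \<open>Integer division yields the index of the cell that contains
      \<open>v\<close>.\<close>
    define z where "z = (\<chi> l. v $ l div t $ l)"
    have "t $ l * z $ l \<le> v $ l \<and> v $ l < t $ l * z $ l + t $ l" for l
    proof -
      have "v $ l = t $ l * z $ l + v $ l mod t $ l" by (simp add: z_def)
      moreover have "0 \<le> v $ l mod t $ l" "v $ l mod t $ l < t $ l" using t[of l] by (auto simp: t_def)
      ultimately show ?thesis by linarith
    qed
    then have vc: "v \<in> cell t z" by (simp add: mem_cell)
    then have "v \<in> lattice_cell c k z" using lattice_cell_eq[OF t] by (simp add: t_def)
    then have "real_vec v \<in> real_cell c k z" by (simp add: lattice_cell_def lattice_points_def)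
    then have "z \<in> Z" using v unfolding Z_def lattice_points_def by blast
    then show "v \<in> outer_cells c C k" unfolding eq using vc by blast
  qed
  fix v assume "v \<in> outer_cells c C k"
  then obtain z where z: "z \<in> Z" "v \<in> cell t z" unfolding eq by blast
  then obtain y where y: "y \<in> C" "y \<in> real_cell c k z" by (auto simp: Z_def)
  \<comment> \<open>The points \<open>y\<close> and \<open>v\<close> share a cell, whose sides bound
    their distance.\<close>
  have "\<bar>y $ l - real_of_int (v $ l)\<bar> \<le> real_vec t $ l" for l
  proof -
    have "real_of_int (t $ l * z $ l) \<le> y $ l" "y $ l < real_of_int (t $ l * z $ l + t $ l)"
      using y(2) mem_real_cell[OF t, where y=y and z=z] by (auto simp: t_def)
    moreover have "t $ l * z $ l \<le> v $ l" "v $ l < t $ l * z $ l + t $ l" using z(2) by (auto simp: mem_cell)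
    then have "real_of_int (t $ l * z $ l) \<le> real_of_int (v $ l)"
      "real_of_int (v $ l) < real_of_int (t $ l * z $ l + t $ l)"
      by (simp_all only: of_int_le_iff of_int_less_iff)
    ultimately show ?thesis unfolding real_vec_def by (simp only: vec_lambda_beta of_int_add)
  qed
  then show "\<exists>y\<in>C. \<forall>l. \<bar>y $ l - real_of_int (v $ l)\<bar> \<le> real_vec t $ l" using y(1) by blast
qed

section \<open>Asymptotic cell counts\<close>

lemma geometric_assumptionD:
  assumes "geometric_assumption D C c"
  obtains p b where "\<And>n. p_convex p (C n)" "0 < b" "\<And>n. C n \<subseteq> (*) (c n) ` cube b"
    "\<And>n. D n = lattice_points (C n)" "\<And>n l. 0 < c n $ l" "\<And>l. filterlim (\<lambda>n. c n $ l) at_top sequentially"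
    "(\<lambda>n. measure lebesgue (C n) / (\<Prod>l\<in>UNIV. c n $ l)) \<longlonglongrightarrow> 1"
proof -
  obtain p b where *: "\<And>n. p_convex p (C n)" "0 < b" "\<And>n. C n \<subseteq> (*) (c n) ` cube b"
    "\<And>n. D n = lattice_points (C n)" "\<And>n l. 0 < c n $ l" "\<And>l. filterlim (\<lambda>n. c n $ l) at_top sequentially"
    "(\<lambda>n. \<Prod>l\<in>UNIV. c n $ l) \<sim>[sequentially] (\<lambda>n. measure lebesgue (C n))"
    using assms unfolding geometric_assumption_def by blast
  \<comment> \<open>Asymptotic equivalence sets the quotient to 1 where both functions vanish; a
    nonzero product excludes this case and leaves the plain quotient.\<close>
  have "(\<Prod>l\<in>UNIV. c n $ l) \<noteq> 0" for n using *(5)[of n] by (simp add: less_imp_neq[symmetric])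
  then have "(\<lambda>n. measure lebesgue (C n) / (\<Prod>l\<in>UNIV. c n $ l)) \<longlonglongrightarrow> 1"
    using asymp_equivD[OF *(7)[THEN asymp_equiv_symI]] by (simp only: simp_thms if_False)
  with *(1-6) show thesis by (rule that)
qed

lemma p_convex_lmeasurable:
  assumes "p_convex p C"
  shows "C \<in> lmeasurable"
proof -
  obtain B where B: "\<forall>i\<in>{1..p}. convex_body (B i)" "C = (\<Union>i\<in>{1..p}. B i)"
    using assms unfolding p_convex_def by blast
  have "compact C" unfolding B(2) using B(1) by (intro compact_UN) (simp_all add: convex_body_def)
  then show ?thesis by (rule lmeasurable_compact)
qed

text \<open>Divided by the product of the scaling factors, the volume bound is a constant times the
  difference of two products, with factors \<open>2 * b + 4 * (r / c)\<close> and
  \<open>2 * b + 2 * (r / c)\<close>. Both products tend to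
  \<open>(2 * b) ^ CARD('d)\<close>.\<close>

lemma box_frontier_cover_negligible:
  fixes c r :: "nat \<Rightarrow> real^'d::finite"
  assumes pc: "\<And>n. p_convex p (C n)" and b: "0 < b" "\<And>n. C n \<subseteq> (*) (c n) ` cube b"
    and c: "\<And>n l. 0 < c n $ l" and r: "\<And>n l. 0 \<le> r n $ l"
    and rc: "\<And>l. (\<lambda>n. r n $ l / c n $ l) \<longlonglongrightarrow> 0"
  obtains S where "\<And>n. S n \<in> lmeasurable" "\<And>n. box_frontier (C n) (r n) \<subseteq> S n"
    "(\<lambda>n. measure lebesgue (S n) / (\<Prod>l\<in>UNIV. c n $ l)) \<longlonglongrightarrow> 0"
proof -
  let ?P = "\<lambda>n. \<Prod>l\<in>UNIV. c n $ l"
  let ?m = "\<lambda>n. p * (card (signs :: (real^'d) set) *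
       ((\<Prod>l\<in>UNIV. 2 * (b *\<^sub>R c n) $ l + 4 * r n $ l) - (\<Prod>l\<in>UNIV. 2 * (b *\<^sub>R c n) $ l + 2 * r n $ l)))"
  let ?E = "\<lambda>n. p * (card (signs :: (real^'d) set) *
       ((\<Prod>l\<in>UNIV. 2 * b + 4 * (r n $ l / c n $ l)) - (\<Prod>l\<in>(UNIV::'d set). 2 * b + 2 * (r n $ l / c n $ l))))"
  have "\<forall>n. \<exists>S. S \<in> lmeasurable \<and> box_frontier (C n) (r n) \<subseteq> S \<and> measure lebesgue S \<le> ?m n"
  proof
    fix n
    have bd: "\<bar>y $ l\<bar> \<le> (b *\<^sub>R c n) $ l" if "y \<in> C n" for y l
      using subsetD[OF b(2) that] mem_scaled_cube[of "c n" y b, OF c] by simp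
    have "0 \<le> (b *\<^sub>R c n) $ l" for l using b(1) c[of n l] by simp
    note cover = box_frontier_p_convex_cover[OF pc bd r this]
    show "\<exists>S. S \<in> lmeasurable \<and> box_frontier (C n) (r n) \<subseteq> S \<and> measure lebesgue S \<le> ?m n"
      by (rule cover) (assumption | intro exI conjI)+
  qed
  from choice[OF this] obtain S where
    S: "\<And>n. S n \<in> lmeasurable" "\<And>n. box_frontier (C n) (r n) \<subseteq> S n" "\<And>n. measure lebesgue (S n) \<le> ?m n"
    by blast
  have P: "0 < ?P n" for n using c by (intro prod_pos) simp
  have q: "(\<Prod>l\<in>UNIV. 2 * (b *\<^sub>R c n) $ l + a * r n $ l) / ?P n = (\<Prod>l\<in>UNIV. 2 * b + a * (r n $ l / c n $ l))" for n a
    unfolding prod_dividef[symmetric]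
  proof (rule prod.cong[OF refl])
    fix l show "(2 * (b *\<^sub>R c n) $ l + a * r n $ l) / c n $ l = 2 * b + a * (r n $ l / c n $ l)"
      using c[of n l] by (simp add: add_divide_distrib)
  qed
  have "?m n / ?P n = ?E n" for n
    unfolding times_divide_eq_right[symmetric] diff_divide_distrib q ..
  then have up: "measure lebesgue (S n) / ?P n \<le> ?E n" for n
    using divide_right_mono[OF S(3)[of n], of "?P n"] P[of n] by simp
  have lo: "0 \<le> measure lebesgue (S n) / ?P n" for n using P[of n] by simp
  have "?E \<longlonglongrightarrow> p * (card (signs :: (real^'d) set) *
       ((\<Prod>l\<in>(UNIV::'d set). 2 * b + 4 * 0) - (\<Prod>l\<in>(UNIV::'d set). 2 * b + 2 * 0)))"
    by (intro tendsto_intros rc)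
  then have "?E \<longlonglongrightarrow> 0" by simp
  then have "(\<lambda>n. measure lebesgue (S n) / ?P n) \<longlonglongrightarrow> 0"
    by (rule tendsto_sandwich[OF eventuallyI[OF lo] eventuallyI[OF up] tendsto_const])
  with S(1,2) show thesis by (rule that)
qed

lemma inverse_root_tendsto_0:
  assumes "admissible (c :: nat \<Rightarrow> real^'d::finite) k"
  shows "(\<lambda>n. 1 / root CARD('d) (real (k n))) \<longlonglongrightarrow> 0"
proof -
  have "filterlim (\<lambda>n. real (k n)) at_top sequentially"
    using assms unfolding admissible_def by (intro filterlim_compose[OF filterlim_real_sequentially]) blast
  then have "(\<lambda>n. 1 / real (k n)) \<longlonglongrightarrow> 0"
    by (intro tendsto_divide_0[OF tendsto_const] filterlim_at_top_imp_at_infinity)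
  then have "(\<lambda>n. root CARD('d) (1 / real (k n))) \<longlonglongrightarrow> root CARD('d) 0"
    by (rule tendsto_real_root)
  then show ?thesis by (simp add: real_root_divide)
qed

section \<open>Side lengths, block sizes and cores asymptotically\<close>

context
  fixes c :: "nat \<Rightarrow> real^'d::finite" and k :: "nat \<Rightarrow> nat"
  assumes c: "\<And>n l. 0 < c n $ l" and k: "admissible c k"
begin

private lemma root_k_pos: "0 < root CARD('d) (real (k n))"
  using k by (simp add: admissible_def real_root_gt_zero)

lemma int_sides_bounds:
  "0 \<le> int_sides (c n) (k n) $ l" "real_of_int (int_sides (c n) (k n) $ l) \<le> c n $ l / root CARD('d) (real (k n))" "c n $ l / root CARD('d) (real (k n)) - 1 < real_of_int (int_sides (c n) (k n) $ l)"
  using c[of n l] root_k_pos[of n] by (auto simp: int_sides_def)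

text \<open>Taking the floor lowers a side by at most 1, which is a relative error of at most
  \<open>root CARD('d) (real (k n)) / c n $ l\<close>.\<close>

lemma int_sides_ratio: "(\<lambda>n. real_of_int (int_sides (c n) (k n) $ l) * root CARD('d) (real (k n)) / c n $ l) \<longlonglongrightarrow> 1"
proof (rule tendsto_sandwich)
  have "(\<lambda>n. 1 - root CARD('d) (real (k n)) / c n $ l) \<longlonglongrightarrow> 1 - 0"
    using k unfolding admissible_def by (intro tendsto_intros) blast
  then show "(\<lambda>n. 1 - root CARD('d) (real (k n)) / c n $ l) \<longlonglongrightarrow> 1" by simp
  have *: "1 - root CARD('d) (real (k n)) / c n $ l \<le> real_of_int (int_sides (c n) (k n) $ l) * root CARD('d) (real (k n)) / c n $ l \<and> real_of_int (int_sides (c n) (k n) $ l) * root CARD('d) (real (k n)) / c n $ l \<le> 1" for n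
  proof -
    define a where "a = root CARD('d) (real (k n)) / c n $ l"
    have a: "0 < a" using root_k_pos c by (simp add: a_def)
    have e: "c n $ l / root CARD('d) (real (k n)) * a = 1" using root_k_pos[of n] c[of n l] by (simp add: a_def)
    have "real_of_int (int_sides (c n) (k n) $ l) * a \<le> c n $ l / root CARD('d) (real (k n)) * a"
      using int_sides_bounds(2)[of n l] a by (intro mult_right_mono) auto
    moreover have "(c n $ l / root CARD('d) (real (k n)) - 1) * a \<le> real_of_int (int_sides (c n) (k n) $ l) * a"
      using int_sides_bounds(3)[of n l] a by (intro mult_right_mono) auto
    moreover have "(c n $ l / root CARD('d) (real (k n)) - 1) * a = 1 - a" unfolding left_diff_distrib e by simp
    ultimately have "1 - a \<le> real_of_int (int_sides (c n) (k n) $ l) * a \<and> real_of_int (int_sides (c n) (k n) $ l) * a \<le> 1" unfolding e by simp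
    then show ?thesis by (simp add: a_def)
  qed
  show "\<forall>\<^sub>F n in sequentially. 1 - root CARD('d) (real (k n)) / c n $ l \<le> real_of_int (int_sides (c n) (k n) $ l) * root CARD('d) (real (k n)) / c n $ l"
    "\<forall>\<^sub>F n in sequentially. real_of_int (int_sides (c n) (k n) $ l) * root CARD('d) (real (k n)) / c n $ l \<le> 1"
    using * by (intro eventuallyI; blast)+
qed simp

lemma int_sides_smallo: "(\<lambda>n. real_of_int (int_sides (c n) (k n) $ l) / c n $ l) \<longlonglongrightarrow> 0"
proof -
  have "(\<lambda>n. (real_of_int (int_sides (c n) (k n) $ l) * root CARD('d) (real (k n)) / c n $ l) * (1 / root CARD('d) (real (k n)))) \<longlonglongrightarrow> 1 * 0"
    by (intro tendsto_mult int_sides_ratio inverse_root_tendsto_0[OF k])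
  moreover have "(real_of_int (int_sides (c n) (k n) $ l) * root CARD('d) (real (k n)) / c n $ l) * (1 / root CARD('d) (real (k n))) = real_of_int (int_sides (c n) (k n) $ l) / c n $ l" for n
    using root_k_pos[of n] by simp
  ultimately show ?thesis by simp
qed

lemma eventually_int_sides_pos: "\<forall>\<^sub>F n in sequentially. \<forall>l. 0 < int_sides (c n) (k n) $ l"
proof -
  have "\<forall>\<^sub>F n in sequentially. 0 < int_sides (c n) (k n) $ l" for l
  proof -
    have "\<forall>\<^sub>F n in sequentially. 0 < real_of_int (int_sides (c n) (k n) $ l) * root CARD('d) (real (k n)) / c n $ l"
      using int_sides_ratio by (rule order_tendstoD) simp
    then show ?thesis
    proof eventually_elim
      case (elim n)
      then show ?case using root_k_pos[of n] c[of n l] by (simp add: zero_less_divide_iff zero_less_mult_iff)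
    qed
  qed
  then have "\<forall>\<^sub>F n in sequentially. \<forall>l\<in>UNIV. 0 < int_sides (c n) (k n) $ l" by (intro eventually_ball_finite) auto
  then show ?thesis by simp
qed

lemma card_block_eq: "real (card (block (int_sides (c n) (k n)))) = (\<Prod>l\<in>UNIV. real_of_int (int_sides (c n) (k n) $ l))"
  by (simp add: finite_card_block int_sides_bounds(1))

text \<open>Multiply the limits of the single sides: the roots, one for each coordinate, combine to
  \<open>k n\<close>.\<close>

lemma card_block_asymp: "(\<lambda>n. real (card (block (int_sides (c n) (k n)))) * real (k n) / (\<Prod>l\<in>UNIV. c n $ l)) \<longlonglongrightarrow> 1"
proof -
  have "(\<lambda>n. \<Prod>l\<in>UNIV. real_of_int (int_sides (c n) (k n) $ l) * root CARD('d) (real (k n)) / c n $ l) \<longlonglongrightarrow> (\<Prod>l\<in>(UNIV::'d set). 1)"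
    by (intro tendsto_prod int_sides_ratio)
  moreover have "(\<Prod>l\<in>UNIV. real_of_int (int_sides (c n) (k n) $ l) * root CARD('d) (real (k n)) / c n $ l) = real (card (block (int_sides (c n) (k n)))) * real (k n) / (\<Prod>l\<in>UNIV. c n $ l)" for n
  proof -
    have "(\<Prod>l\<in>(UNIV::'d set). root CARD('d) (real (k n))) = k n" by simp
    then show ?thesis unfolding prod_dividef prod.distrib card_block_eq by simp
  qed
  ultimately show ?thesis by simp
qed

text \<open>The margin \<open>g\<close>, the least integer strictly above
  \<open>\<bar>\<gamma>\<bar>\<close>, is of smaller order than the side of the block. So the core
  occupies asymptotically the full side in each coordinate, and the product over the coordinates
  tends to 1.\<close>

lemma card_block_minus_core_asymp:
  assumes \<gamma>: "vec_smallo (\<lambda>n. root CARD('d) (real (k n)) *\<^sub>R \<gamma> n) c"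
  defines "g \<equiv> \<lambda>n. \<chi> l. \<lfloor>\<bar>\<gamma> n $ l\<bar>\<rfloor> + 1"
  shows "(\<lambda>n. card (block (int_sides (c n) (k n)) - core (int_sides (c n) (k n)) (g n)) / card (block (int_sides (c n) (k n)))) \<longlonglongrightarrow> 0"
proof -
  have g: "0 < g n $ l" "real_of_int (g n $ l) \<le> \<bar>\<gamma> n $ l\<bar> + 1" for n l
    unfolding g_def by (simp_all add: add_nonneg_pos)
  \<comment> \<open>For positive sides this is \<open>\<bar>\<gamma> n $ l\<bar> + 1\<close> divided
    by the side, with numerator and denominator scaled so that both have known limits.\<close>
  define a where "a n l = (root CARD('d) (real (k n)) * \<bar>\<gamma> n $ l\<bar> / c n $ l + root CARD('d) (real (k n)) / c n $ l) / (real_of_int (int_sides (c n) (k n) $ l) * root CARD('d) (real (k n)) / c n $ l)" for n l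
  have a: "(\<lambda>n. a n l) \<longlonglongrightarrow> 0" for l
  proof -
    have "(\<lambda>n. \<bar>(root CARD('d) (real (k n)) *\<^sub>R \<gamma> n) $ l / c n $ l\<bar>) \<longlonglongrightarrow> 0"
      using \<gamma> unfolding vec_smallo_def by (intro tendsto_rabs_zero) blast
    moreover have "\<bar>(root CARD('d) (real (k n)) *\<^sub>R \<gamma> n) $ l / c n $ l\<bar> = root CARD('d) (real (k n)) * \<bar>\<gamma> n $ l\<bar> / c n $ l" for n
      using root_k_pos[of n] c[of n l] by (simp add: abs_mult abs_divide)
    ultimately have "(\<lambda>n. root CARD('d) (real (k n)) * \<bar>\<gamma> n $ l\<bar> / c n $ l) \<longlonglongrightarrow> 0" by simp
    moreover have "(\<lambda>n. root CARD('d) (real (k n)) / c n $ l) \<longlonglongrightarrow> 0" using k unfolding admissible_def by blast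
    ultimately have "(\<lambda>n. a n l) \<longlonglongrightarrow> (0 + 0) / 1"
      unfolding a_def by (intro tendsto_divide tendsto_add int_sides_ratio) auto
    then show ?thesis by simp
  qed
  have pos: "\<forall>\<^sub>F n in sequentially. \<forall>l. 0 < int_sides (c n) (k n) $ l" by (rule eventually_int_sides_pos)
  have factor: "(\<lambda>n. real (nat (int_sides (c n) (k n) $ l - 2 * g n $ l + 1)) / real_of_int (int_sides (c n) (k n) $ l)) \<longlonglongrightarrow> 1" for l
  proof (rule tendsto_sandwich)
    have "(\<lambda>n. 1 - 2 * a n l) \<longlonglongrightarrow> 1 - 2 * 0" by (intro tendsto_intros a)
    then show "(\<lambda>n. 1 - 2 * a n l) \<longlonglongrightarrow> 1" by simp
    show "\<forall>\<^sub>F n in sequentially. 1 - 2 * a n l \<le> real (nat (int_sides (c n) (k n) $ l - 2 * g n $ l + 1)) / real_of_int (int_sides (c n) (k n) $ l)"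
      using pos
    proof eventually_elim
      case (elim n)
      then have tp: "0 < real_of_int (int_sides (c n) (k n) $ l)" by simp
      have "a n l = (\<bar>\<gamma> n $ l\<bar> + 1) / real_of_int (int_sides (c n) (k n) $ l)"
        using root_k_pos[of n] c[of n l] tp unfolding a_def by (simp add: field_simps)
      then have "1 - 2 * a n l = (real_of_int (int_sides (c n) (k n) $ l) - 2 * (\<bar>\<gamma> n $ l\<bar> + 1)) / real_of_int (int_sides (c n) (k n) $ l)"
        using tp by (simp add: diff_divide_distrib)
      also have "\<dots> \<le> real (nat (int_sides (c n) (k n) $ l - 2 * g n $ l + 1)) / real_of_int (int_sides (c n) (k n) $ l)"
      proof (rule divide_right_mono)
        have "real_of_int (int_sides (c n) (k n) $ l - 2 * g n $ l) \<le> real (nat (int_sides (c n) (k n) $ l - 2 * g n $ l + 1))" by linarith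
        then show "real_of_int (int_sides (c n) (k n) $ l) - 2 * (\<bar>\<gamma> n $ l\<bar> + 1) \<le> real (nat (int_sides (c n) (k n) $ l - 2 * g n $ l + 1))"
          using g(2)[of n l] by simp
      qed (use tp in simp)
      finally show ?case .
    qed
    show "\<forall>\<^sub>F n in sequentially. real (nat (int_sides (c n) (k n) $ l - 2 * g n $ l + 1)) / real_of_int (int_sides (c n) (k n) $ l) \<le> 1"
      using pos
    proof eventually_elim
      case (elim n)
      then have tp: "0 < int_sides (c n) (k n) $ l" by simp
      have "nat (int_sides (c n) (k n) $ l - 2 * g n $ l + 1) \<le> int_sides (c n) (k n) $ l" using tp g(1)[of n l] by linarith
      then have "real (nat (int_sides (c n) (k n) $ l - 2 * g n $ l + 1)) \<le> real_of_int (int_sides (c n) (k n) $ l)" by linarith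
      then show ?case using tp by (simp add: divide_le_eq)
    qed
  qed simp
  have "(\<lambda>n. 1 - (\<Prod>l\<in>UNIV. real (nat (int_sides (c n) (k n) $ l - 2 * g n $ l + 1)) / real_of_int (int_sides (c n) (k n) $ l))) \<longlonglongrightarrow> 1 - (\<Prod>l\<in>(UNIV::'d set). 1)"
    by (intro tendsto_diff tendsto_const tendsto_prod factor)
  then have lim: "(\<lambda>n. 1 - (\<Prod>l\<in>UNIV. real (nat (int_sides (c n) (k n) $ l - 2 * g n $ l + 1)) / real_of_int (int_sides (c n) (k n) $ l))) \<longlonglongrightarrow> 0" by simp
  have "\<forall>\<^sub>F n in sequentially. 1 - (\<Prod>l\<in>UNIV. real (nat (int_sides (c n) (k n) $ l - 2 * g n $ l + 1)) / real_of_int (int_sides (c n) (k n) $ l))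
      = card (block (int_sides (c n) (k n)) - core (int_sides (c n) (k n)) (g n)) / card (block (int_sides (c n) (k n)))"
    using pos
  proof eventually_elim
    case (elim n)
    have sub: "core (int_sides (c n) (k n)) (g n) \<subseteq> block (int_sides (c n) (k n))" using g(1) by (rule core_subset_block)
    have ne: "(\<Prod>l\<in>UNIV. real_of_int (int_sides (c n) (k n) $ l)) \<noteq> 0" using elim by (simp add: less_imp_neq[symmetric])
    have "real (card (block (int_sides (c n) (k n)) - core (int_sides (c n) (k n)) (g n))) = real (card (block (int_sides (c n) (k n)))) - real (card (core (int_sides (c n) (k n)) (g n)))"
      using sub finite_card_block(1)[of "int_sides (c n) (k n)"] by (simp add: card_Diff_subset finite_subset card_mono of_nat_diff)
    then show ?case
      unfolding prod_dividef card_block_eq card_core using ne by (simp add: diff_divide_distrib)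
  qed
  then show ?thesis by (rule Lim_transform_eventually[OF lim])
qed

end

text \<open>A sandwich: \<open>card (D n)\<close> is at least the volume of \<open>C n\<close> minus
  a cover of its frontier of radius 1, eventually \<open>D n\<close> lies in the union of the cells,
  and that union has at most the volume of \<open>C n\<close> plus a cover of the frontier whose
  radius is one more than the sides. Both covers are negligible against the product of the scaling
  factors.\<close>

lemma card_asymp:
  fixes c :: "nat \<Rightarrow> real^'d::finite"
  assumes geo: "geometric_assumption D C c" and k: "admissible c k"
    and fin: "\<And>n. finite (outer_cells (c n) (C n) (k n))"
  shows "\<And>n. finite (D n)"
    and "(\<lambda>n. card (D n) / (\<Prod>l\<in>UNIV. c n $ l)) \<longlonglongrightarrow> 1"
    and "(\<lambda>n. card (outer_cells (c n) (C n) (k n)) / (\<Prod>l\<in>UNIV. c n $ l)) \<longlonglongrightarrow> 1"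
proof -
  let ?P = "\<lambda>n. \<Prod>l\<in>UNIV. c n $ l"
  let ?t = "\<lambda>n. int_sides (c n) (k n)"
  let ?O = "\<lambda>n. outer_cells (c n) (C n) (k n)"
  obtain p b where pc: "\<And>n. p_convex p (C n)" and b: "0 < b" "\<And>n. C n \<subseteq> (*) (c n) ` cube b"
    and D: "\<And>n. D n = lattice_points (C n)" and c: "\<And>n l. 0 < c n $ l"
    and cinf: "\<And>l. filterlim (\<lambda>n. c n $ l) at_top sequentially"
    and vol: "(\<lambda>n. measure lebesgue (C n) / ?P n) \<longlonglongrightarrow> 1"
    by (rule geometric_assumptionD[OF geo]) (rule that)
  have C: "C n \<in> lmeasurable" for n by (rule p_convex_lmeasurable[OF pc])
  have P: "0 < ?P n" for n using c by (intro prod_pos) simp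
  have "D n \<subseteq> window (c n) b" for n unfolding D window_def lattice_points_def using b(2) by blast
  then show finD: "finite (D n)" for n using finite_window[OF c] finite_subset by blast
  have 1: "(\<lambda>n. (1::real^'d) $ l / c n $ l) \<longlonglongrightarrow> 0" for l
    by (intro tendsto_divide_0[OF tendsto_const] filterlim_at_top_imp_at_infinity cinf)
  obtain S where S: "\<And>n. S n \<in> lmeasurable" "\<And>n. box_frontier (C n) 1 \<subseteq> S n" "(\<lambda>n. measure lebesgue (S n) / ?P n) \<longlonglongrightarrow> 0"
    using box_frontier_cover_negligible[of p C b c "\<lambda>_. 1", OF pc b c _ 1] by auto
  have t0: "0 \<le> ?t n $ l" for n l by (rule int_sides_bounds(1)[OF c k])
  have r0: "0 \<le> real_vec (?t n) $ l" for n l using t0[of n l] by (simp add: real_vec_def)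
  have t1: "0 \<le> (real_vec (?t n) + 1) $ l" for n l using r0[of n l] by simp
  have "(\<lambda>n. real_of_int (?t n $ l) / c n $ l + 1 $ l / c n $ l) \<longlonglongrightarrow> 0 + 0" for l
    by (intro tendsto_add int_sides_smallo[OF c k] 1)
  then have t2: "(\<lambda>n. (real_vec (?t n) + 1) $ l / c n $ l) \<longlonglongrightarrow> 0" for l
    by (simp add: real_vec_def add_divide_distrib)
  obtain S' where S': "\<And>n. S' n \<in> lmeasurable" "\<And>n. box_frontier (C n) (real_vec (?t n) + 1) \<subseteq> S' n"
    "(\<lambda>n. measure lebesgue (S' n) / ?P n) \<longlonglongrightarrow> 0"
    by (rule box_frontier_cover_negligible[of p C b c "\<lambda>n. real_vec (?t n) + 1", OF pc b c t1 t2]) (rule that)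
  have "(\<lambda>n. measure lebesgue (C n) / ?P n - measure lebesgue (S n) / ?P n) \<longlonglongrightarrow> 1 - 0"
    by (intro tendsto_diff vol S(3))
  then have lo: "(\<lambda>n. measure lebesgue (C n) / ?P n - measure lebesgue (S n) / ?P n) \<longlonglongrightarrow> 1" by simp
  have "(\<lambda>n. measure lebesgue (C n) / ?P n + measure lebesgue (S' n) / ?P n) \<longlonglongrightarrow> 1 + 0"
    by (intro tendsto_add vol S'(3))
  then have hi: "(\<lambda>n. measure lebesgue (C n) / ?P n + measure lebesgue (S' n) / ?P n) \<longlonglongrightarrow> 1" by simp
  have lo': "measure lebesgue (C n) / ?P n - measure lebesgue (S n) / ?P n \<le> card (D n) / ?P n" for n
  proof -
    have "measure lebesgue (C n) - measure lebesgue (S n) \<le> card (D n)"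
      using card_lattice_points_ge[OF finD[of n, unfolded D] S(1,2) fmeasurableD[OF C]] by (simp add: D)
    then show ?thesis unfolding diff_divide_distrib[symmetric] using P[of n] by (intro divide_right_mono) auto
  qed
  have pos: "\<forall>\<^sub>F n in sequentially. \<forall>l. 0 < ?t n $ l" by (rule eventually_int_sides_pos[OF c k])
  have mid: "\<forall>\<^sub>F n in sequentially. card (D n) / ?P n \<le> card (?O n) / ?P n"
    using pos
  proof eventually_elim
    case (elim n)
    have "D n \<subseteq> ?O n" unfolding D using elim by (intro outer_cells_properties(4) fin) blast
    then have "card (D n) \<le> card (?O n)" by (rule card_mono[OF fin])
    then show ?case using P[of n] by (intro divide_right_mono) auto
  qed
  have hi': "\<forall>\<^sub>F n in sequentially. card (?O n) / ?P n \<le> measure lebesgue (C n) / ?P n + measure lebesgue (S' n) / ?P n"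
    using pos
  proof eventually_elim
    case (elim n)
    have "\<exists>y\<in>C n. \<forall>l. \<bar>y $ l - real_of_int (v $ l)\<bar> \<le> real_vec (?t n) $ l" if "v \<in> ?O n" for v
      using elim that by (intro outer_cells_properties(5)[OF _ fin]) auto
    then have "card (?O n) \<le> measure lebesgue (C n) + measure lebesgue (S' n)"
      by (rule card_near_le[OF fin _ r0 S'(1,2) C])
    then show ?case unfolding add_divide_distrib[symmetric] using P[of n] by (intro divide_right_mono) auto
  qed
  have D_hi: "\<forall>\<^sub>F n in sequentially. card (D n) / ?P n \<le> measure lebesgue (C n) / ?P n + measure lebesgue (S' n) / ?P n"
    using mid hi' by eventually_elim linarith
  have O_lo: "\<forall>\<^sub>F n in sequentially. measure lebesgue (C n) / ?P n - measure lebesgue (S n) / ?P n \<le> card (?O n) / ?P n"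
    using mid
  proof eventually_elim
    case (elim n)
    then show ?case using lo'[of n] by linarith
  qed
  show "(\<lambda>n. card (D n) / ?P n) \<longlonglongrightarrow> 1"
    by (rule tendsto_sandwich[OF eventuallyI[OF lo'] D_hi lo hi])
  show "(\<lambda>n. card (?O n) / ?P n) \<longlonglongrightarrow> 1"
    by (rule tendsto_sandwich[OF O_lo hi' lo hi])
qed

section \<open>Asymptotics of the maximum\<close>

lemma abs_exp_neg_diff_le:
  fixes a b :: real
  assumes "0 \<le> a" "0 \<le> b"
  shows "\<bar>exp (- a) - exp (- b)\<bar> \<le> \<bar>a - b\<bar>"
proof -
  have *: "exp (- a) - exp (- b) \<le> b - a \<and> exp (- b) \<le> exp (- a)" if "a \<le> b" "0 \<le> a" for a b :: real
  proof
    have "exp (- a) - exp (- b) = exp (- a) * (1 - exp (- (b - a)))"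
      by (simp add: right_diff_distrib flip: exp_add)
    also have "1 - exp (- (b - a)) \<le> b - a" using exp_ge_add_one_self[of "- (b - a)"] by linarith
    then have "exp (- a) * (1 - exp (- (b - a))) \<le> 1 * (b - a)"
      using that by (intro mult_mono) auto
    finally show "exp (- a) - exp (- b) \<le> b - a" by simp
  qed (use that in simp)
  show ?thesis
  proof (cases "a \<le> b")
    case True
    then show ?thesis using *[OF True assms(1)] by linarith
  next
    case False
    then show ?thesis using *[of b a] assms(2) by linarith
  qed
qed

text \<open>On the unit interval \<open>1 - q\<close> and \<open>exp (- q)\<close> differ by at most
  the square of \<open>q\<close>, and taking powers of two numbers of modulus at most 1 multiplies
  their distance by at most the exponent.\<close>

lemma abs_power_minus_exp_le:
  fixes q :: real
  assumes "0 \<le> q" "q \<le> 1"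
  shows "\<bar>(1 - q) ^ N - exp (- (real N * q))\<bar> \<le> N * q\<^sup>2"
proof -
  \<comment> \<open>The right-hand side equals \<open>1 + q ^ 3\<close>.\<close>
  have "1 \<le> (1 - q + q\<^sup>2) * (1 + q)"
    using assms by (simp add: algebra_simps power2_eq_square)
  also have "\<dots> \<le> (1 - q + q\<^sup>2) * exp q"
    using assms exp_ge_add_one_self[of q] by (intro mult_left_mono) auto
  finally have "exp (- q) \<le> 1 - q + q\<^sup>2" by (simp add: exp_minus divide_simps)
  moreover have "1 - q \<le> exp (- q)" using exp_ge_add_one_self[of "- q"] by simp
  ultimately have "norm ((1 - q) - exp (- q)) \<le> q\<^sup>2" by simp
  moreover have "norm ((1 - q) ^ N - exp (- q) ^ N) \<le> N * norm ((1 - q) - exp (- q))"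
    using assms by (intro norm_power_diff) auto
  ultimately have "norm ((1 - q) ^ N - exp (- q) ^ N) \<le> N * q\<^sup>2"
    by (meson mult_left_mono of_nat_0_le_iff order_trans)
  then show ?thesis by (simp add: exp_of_nat_mult[symmetric])
qed

text \<open>Let \<open>k\<close> grow like \<open>1 / sqrt (w n)\<close> for a positive null
  sequence \<open>w\<close> above \<open>\<bar>u\<bar>\<close>; then \<open>k * w\<close> is of the
  order of \<open>sqrt (w n)\<close>.\<close>

lemma null_sequence_slow_growth:
  fixes u :: "nat \<Rightarrow> real"
  assumes "u \<longlonglongrightarrow> 0"
  obtains k :: "nat \<Rightarrow> nat" where "\<And>n. 0 < k n" "filterlim k at_top sequentially" "(\<lambda>n. real (k n) * u n) \<longlonglongrightarrow> 0"
proof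
  \<comment> \<open>The second summand keeps \<open>w\<close> positive even where \<open>u\<close>
    vanishes, so that its inverse root tends to infinity.\<close>
  define w where "w n = \<bar>u n\<bar> + 1 / real (Suc n)" for n
  have w0: "0 < w n" for n by (simp add: w_def add_nonneg_pos)
  have "w \<longlonglongrightarrow> \<bar>0\<bar> + 0" unfolding w_def
    by (intro tendsto_add tendsto_rabs assms LIMSEQ_Suc[OF lim_1_over_n])
  then have w: "w \<longlonglongrightarrow> 0" by simp
  define k where "k n = nat \<lceil>1 / sqrt (w n)\<rceil>" for n
  have k: "1 / sqrt (w n) \<le> real (k n)" "real (k n) \<le> 1 / sqrt (w n) + 1" for n
  proof -
    have "0 < 1 / sqrt (w n)" using w0[of n] by simp
    then show "1 / sqrt (w n) \<le> real (k n)" "real (k n) \<le> 1 / sqrt (w n) + 1"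
      unfolding k_def by linarith+
  qed
  show "0 < k n" for n
  proof -
    have "0 < 1 / sqrt (w n)" using w0[of n] by simp
    then have "0 < real (k n)" using k(1)[of n] by linarith
    then show ?thesis by simp
  qed
  have sw: "(\<lambda>n. sqrt (w n)) \<longlonglongrightarrow> 0" using tendsto_real_sqrt[OF w] by simp
  have "filterlim (\<lambda>n. inverse (sqrt (w n))) at_top sequentially"
    using w0 by (intro filterlim_inverse_at_top[OF sw] eventuallyI) simp
  then have "filterlim (\<lambda>n. real (k n)) at_top sequentially"
    by (rule filterlim_at_top_mono) (intro eventuallyI, simp only: inverse_eq_divide k(1))
  then show "filterlim k at_top sequentially"
    by (simp add: filterlim_sequentially_iff_filterlim_real)
  have "\<bar>real (k n) * u n\<bar> \<le> sqrt (w n) + w n" for n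
  proof -
    have "\<bar>real (k n) * u n\<bar> = real (k n) * \<bar>u n\<bar>" by (simp add: abs_mult)
    also have "\<dots> \<le> (1 / sqrt (w n) + 1) * w n"
      using k(2)[of n] w0[of n] by (intro mult_mono) (auto simp: w_def)
    also have "\<dots> = w n / sqrt (w n) + w n" by (simp only: distrib_right mult_1_left times_divide_eq_left)
    also have "\<dots> = sqrt (w n) + w n" using w0[of n] by (simp only: real_div_sqrt less_imp_le)
    finally show ?thesis .
  qed
  then have "norm (real (k n) * u n) \<le> sqrt (w n) + w n" for n by (simp only: real_norm_def)
  moreover have "(\<lambda>n. sqrt (w n) + w n) \<longlonglongrightarrow> 0" using tendsto_add[OF sw w] by (simp only: add_0_left)
  ultimately show "(\<lambda>n. real (k n) * u n) \<longlonglongrightarrow> 0"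
    by (rule Lim_null_comparison[OF eventuallyI])
qed

text \<open>Here \<open>h\<close> and \<open>h'\<close> stand for the exceedance probabilities of
  the index set and of the union of its cells, \<open>q\<close> for that of a block with union bound
  \<open>u\<close>, \<open>f\<close> for the approximation of \<open>q\<close> by local last
  exceedances, \<open>w\<close> for the expected number of exceedances in all cells, and
  \<open>p\<close> for the conditional probability. The chain passes from \<open>1 - h\<close> over
  \<open>1 - h'\<close>, \<open>(1 - q) ^ N\<close> and \<open>exp (- (N * q))\<close> to the
  exponential of \<open>- (\<tau> * p)\<close>.\<close>

lemma maximum_error_chain:
  fixes h h' e q f u w p \<tau> \<alpha> \<delta> m :: real and N :: nat
  assumes h: "h \<le> h'" "h' \<le> h + e" and pow: "\<bar>(1 - h') - (1 - q) ^ N\<bar> \<le> N * (\<alpha> + 2 * \<delta>)"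
    and q: "0 \<le> q" "q \<le> 1" "q \<le> u" and f: "\<bar>q - f\<bar> \<le> \<alpha> + \<delta> + m * u\<^sup>2"
    and w: "N * f = w * p" and p: "0 \<le> p" "p \<le> 1" and \<tau>: "0 \<le> \<tau>"
  shows "\<bar>(1 - h) - exp (- (\<tau> * p))\<bar>
    \<le> e + N * (\<alpha> + 2 * \<delta>) + N * u\<^sup>2 + N * (\<alpha> + \<delta> + m * u\<^sup>2) + \<bar>w - \<tau>\<bar>"
proof -
  have 1: "\<bar>(1 - q) ^ N - exp (- (N * q))\<bar> \<le> N * u\<^sup>2"
  proof -
    have "N * q\<^sup>2 \<le> N * u\<^sup>2" using q by (intro mult_left_mono power_mono) auto
    then show ?thesis using abs_power_minus_exp_le[OF q(1,2), of N] by linarith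
  qed
  have 2: "\<bar>exp (- (N * q)) - exp (- (\<tau> * p))\<bar> \<le> \<bar>N * q - \<tau> * p\<bar>"
    using q p \<tau> by (intro abs_exp_neg_diff_le) auto
  have 3: "\<bar>N * q - N * f\<bar> \<le> N * (\<alpha> + \<delta> + m * u\<^sup>2)"
  proof -
    have "\<bar>N * q - N * f\<bar> = N * \<bar>q - f\<bar>" unfolding right_diff_distrib[symmetric] abs_mult by simp
    also have "\<dots> \<le> N * (\<alpha> + \<delta> + m * u\<^sup>2)" using f by (intro mult_left_mono) auto
    finally show ?thesis .
  qed
  have 4: "\<bar>w * p - \<tau> * p\<bar> \<le> \<bar>w - \<tau>\<bar>"
  proof -
    have "\<bar>w * p - \<tau> * p\<bar> = \<bar>w - \<tau>\<bar> * p" unfolding left_diff_distrib[symmetric] abs_mult using p by simp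
    also have "\<dots> \<le> \<bar>w - \<tau>\<bar> * 1" using p by (intro mult_left_mono) auto
    finally show ?thesis by simp
  qed
  show ?thesis using h pow 1 2 3 4 unfolding w by linarith
qed

section \<open>The asymptotic identity for the maximum\<close>

context stationary_field
begin

lemma prob_tail: "\<P>(\<omega> in M. \<xi> 0 \<omega> > x) = prob (hit x {0})"
  by (simp add: hit_def)

lemma cond_prob_field_max:
  fixes A :: "(int^'d) set" and x :: real
  defines "p \<equiv> \<P>(\<omega> in M. field_max \<xi> A \<omega> \<le> ereal x \<bar> \<xi> 0 \<omega> > x)"
  shows "prob (hit x {0}) * p = prob (hit x {0} - hit x A)" "0 \<le> p" "p \<le> 1"
proof -
  have eq: "{\<omega> \<in> space M. field_max \<xi> A \<omega> \<le> ereal x \<and> \<xi> 0 \<omega> > x} = hit x {0} - hit x A"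
    by (auto simp: field_max_def SUP_le_iff hit_def not_less)
  have p: "p = prob (hit x {0} - hit x A) / prob (hit x {0})"
    unfolding p_def cond_prob_def eq prob_tail ..
  have le: "prob (hit x {0} - hit x A) \<le> prob (hit x {0})" by (intro finite_measure_mono) auto
  show "prob (hit x {0}) * p = prob (hit x {0} - hit x A)"
  proof (cases "prob (hit x {0}) = 0")
    \<comment> \<open>If exceedances have probability 0, the conditional probability is a division
      by zero with value 0, and both sides vanish.\<close>
    case True
    then have "prob (hit x {0} - hit x A) = 0" using le measure_nonneg[of M "hit x {0} - hit x A"] by linarith
    then show ?thesis using True by simp
  qed (simp add: p)
  show "0 \<le> p" by (simp add: p)
  show "p \<le> 1" unfolding p using le by (simp add: divide_le_eq measure_nonneg less_le)
qed

text \<open>For ordered levels the difference of the two events for \<open>A\<close> is covered by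
  the differences at single sites, which all have the same probability. This makes the limit law of
  the maximum independent of the chosen level sequence.\<close>

lemma prob_hit_level_diff:
  assumes "finite A"
  shows "\<bar>prob (hit x A) - prob (hit y A)\<bar> \<le> card A * \<bar>prob (hit x {0}) - prob (hit y {0})\<bar>"
proof -
  have *: "\<bar>prob (hit x A) - prob (hit y A)\<bar> \<le> card A * \<bar>prob (hit x {0}) - prob (hit y {0})\<bar>" if "x \<le> y" for x y
  proof -
    have sub: "hit y B \<subseteq> hit x B" for B unfolding hit_def using that order_le_less_trans by blast
    have d: "prob (hit x B - hit y B) = prob (hit x B) - prob (hit y B)" for B
      by (rule finite_measure_Diff[OF sets_hit sets_hit sub])
    have "hit x A - hit y A \<subseteq> (\<Union>v\<in>A. hit x {v} - hit y {v})" by (auto simp: hit_def)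
    then have "prob (hit x A - hit y A) \<le> prob (\<Union>v\<in>A. hit x {v} - hit y {v})"
      using assms by (intro finite_measure_mono) auto
    also have "\<dots> \<le> (\<Sum>v\<in>A. prob (hit x {v} - hit y {v}))"
      using assms by (intro finite_measure_subadditive_finite) auto
    also have "\<dots> = (\<Sum>v\<in>A. prob (hit x {0}) - prob (hit y {0}))"
    proof (rule sum.cong[OF refl])
      fix v show "prob (hit x {v} - hit y {v}) = prob (hit x {0}) - prob (hit y {0})"
        unfolding d prob_hit_single[of x v] prob_hit_single[of y v] ..
    qed
    also have "\<dots> = card A * (prob (hit x {0}) - prob (hit y {0}))" by simp
    finally have le: "prob (hit x A - hit y A) \<le> card A * (prob (hit x {0}) - prob (hit y {0}))" .
    have "prob (hit y A) \<le> prob (hit x A)" "prob (hit y {0}) \<le> prob (hit x {0})"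
      using sub by (auto intro!: finite_measure_mono)
    then show ?thesis using le unfolding d by simp
  qed
  show ?thesis
  proof (cases "x \<le> y")
    case False
    then show ?thesis using *[of y x] by (simp only: abs_minus_commute not_le less_imp_le)
  qed (rule *)
qed

text \<open>The error terms vanish because the number \<open>N\<close> of cells is asymptotic to
  \<open>k\<close>, while the expected number of exceedances in one cell is at most of order
  \<open>1 / k\<close>.\<close>

lemma prob_maximum_asymp:
  fixes c :: "nat \<Rightarrow> real^'d"
  assumes geo: "geometric_assumption D C c" and \<kappa>: "0 < \<kappa>"
    and out: "\<And>n. outer_cells (c n) (C n) (k n) \<subseteq> window (c n) \<kappa>"
    and R: "linear_order R" "translation_invariant R"
    and tail: "(\<lambda>n. card (D n) * prob (hit (x n) {0})) \<longlonglongrightarrow> \<tau>" and \<tau>: "0 \<le> \<tau>"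
    and mix: "mixing_condition M \<xi> c x (\<lambda>n. window (c n) \<kappa>) \<alpha> \<gamma>"
    and k: "admissible c k" and k\<alpha>: "(\<lambda>n. real (k n) * \<alpha> n) \<longlonglongrightarrow> 0"
    and k\<gamma>: "vec_smallo (\<lambda>n. root CARD('d) (real (k n)) *\<^sub>R \<gamma> n) c"
  shows "(\<lambda>n. (1 - prob (hit (x n) (D n))) - exp (- (\<tau> *
    \<P>(\<omega> in M. field_max \<xi> (successors R (c n) (k n) 0) \<omega> \<le> ereal (x n) \<bar> \<xi> 0 \<omega> > x n)))) \<longlonglongrightarrow> 0"
proof -
  define P where "P n = (\<Prod>l\<in>UNIV. c n $ l)" for n
  define t where "t n = int_sides (c n) (k n)" for n
  define g where "g n = (\<chi> l. \<lfloor>\<bar>\<gamma> n $ l\<bar>\<rfloor> + 1)" for n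
  define Out where "Out n = outer_cells (c n) (C n) (k n)" for n
  define Z where "Z n = {z. real_cell (c n) (k n) z \<inter> C n \<noteq> {}}" for n
  define p where "p n = prob (hit (x n) {0})" for n
  define N where "N n = card (Z n)" for n
  define J where "J n = real (card (block (t n)))" for n
  define d where "d n = real (card (block (t n) - core (t n) (g n)))" for n
  define \<pi> where "\<pi> n = \<P>(\<omega> in M. field_max \<xi> (successors R (c n) (k n) 0) \<omega> \<le> ereal (x n) \<bar> \<xi> 0 \<omega> > x n)" for n
  have c: "0 < c n $ l" for n l using geo unfolding geometric_assumption_def by blast
  have DC: "D n = lattice_points (C n)" for n using geo unfolding geometric_assumption_def by blast
  have kpos: "0 < k n" for n using k by (simp add: admissible_def)
  have Ppos: "0 < P n" for n unfolding P_def using c by (intro prod_pos) simp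
  have fin: "finite (Out n)" for n
    unfolding Out_def using out finite_window[OF c] by (rule finite_subset)
  note asymp = card_asymp[OF geo k fin[unfolded Out_def]]
  have D1: "(\<lambda>n. card (D n) / P n) \<longlonglongrightarrow> 1" using asymp(2) unfolding P_def .
  have O1: "(\<lambda>n. card (Out n) / P n) \<longlonglongrightarrow> 1" using asymp(3) unfolding P_def Out_def .
  have J1: "(\<lambda>n. J n * k n / P n) \<longlonglongrightarrow> 1" using card_block_asymp[OF c k] unfolding P_def J_def t_def .
  have d0: "(\<lambda>n. d n / J n) \<longlonglongrightarrow> 0"
    using card_block_minus_core_asymp[OF c k k\<gamma>] unfolding d_def J_def t_def g_def .
  have tpos: "\<forall>\<^sub>F n in sequentially. \<forall>l. 0 < t n $ l"
    unfolding t_def by (rule eventually_int_sides_pos[OF c k])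
  have Jpos: "0 < J n" if "\<forall>l. 0 < t n $ l" for n
    unfolding J_def t_def card_block_eq[OF c k] using that unfolding t_def by (intro prod_pos) simp
  have OJ: "card (Out n) = N n * J n" if "\<forall>l. 0 < t n $ l" for n
    using outer_cells_properties(3)[of "c n" "k n" "C n"] that fin[of n]
    unfolding Out_def N_def J_def t_def Z_def by simp
  \<comment> \<open>As \<open>card (D n)\<close> is asymptotic to \<open>P n\<close>, the tail
    condition carries over to the product of the scaling factors.\<close>
  have Pp: "(\<lambda>n. P n * p n) \<longlonglongrightarrow> \<tau>"
  proof -
    have "(\<lambda>n. (card (D n) * p n) / (card (D n) / P n)) \<longlonglongrightarrow> \<tau> / 1"
      by (intro tendsto_divide D1 tail[folded p_def]) simp
    moreover have "\<forall>\<^sub>F n in sequentially. (card (D n) * p n) / (card (D n) / P n) = P n * p n"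
      using order_tendstoD(1)[OF D1 zero_less_one]
    proof eventually_elim
      case (elim n)
      then show ?case using Ppos[of n] by (auto simp: zero_less_divide_iff)
    qed
    ultimately show ?thesis by (simp add: Lim_transform_eventually)
  qed
  have Op: "(\<lambda>n. card (Out n) * p n) \<longlonglongrightarrow> \<tau>"
  proof -
    have "(\<lambda>n. card (Out n) / P n * (P n * p n)) \<longlonglongrightarrow> 1 * \<tau>" by (intro tendsto_mult O1 Pp)
    moreover have "card (Out n) / P n * (P n * p n) = card (Out n) * p n" for n using Ppos[of n] by simp
    ultimately show ?thesis by simp
  qed
  have k_inf: "(\<lambda>n. 1 / real (k n)) \<longlonglongrightarrow> 0"
  proof -
    have "filterlim (\<lambda>n. real (k n)) at_top sequentially"
      using k unfolding admissible_def by (intro filterlim_compose[OF filterlim_real_sequentially]) blast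
    then show ?thesis by (intro tendsto_divide_0[OF tendsto_const] filterlim_at_top_imp_at_infinity)
  qed
  have u0: "(\<lambda>n. J n * p n) \<longlonglongrightarrow> 0"
  proof -
    have "(\<lambda>n. J n * k n / P n * (P n * p n) * (1 / real (k n))) \<longlonglongrightarrow> 1 * \<tau> * 0"
      by (intro tendsto_mult J1 Pp k_inf)
    moreover have "J n * k n / P n * (P n * p n) * (1 / real (k n)) = J n * p n" for n
      using Ppos[of n] kpos[of n] by simp
    ultimately show ?thesis by simp
  qed
  \<comment> \<open>The quotient of the two ratios is eventually \<open>N n / k n\<close>, which
    tends to 1.\<close>
  have N\<alpha>: "(\<lambda>n. N n * \<alpha> n) \<longlonglongrightarrow> 0"
  proof -
    have "(\<lambda>n. (card (Out n) / P n) / (J n * k n / P n) * (k n * \<alpha> n)) \<longlonglongrightarrow> 1 / 1 * 0"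
      by (intro tendsto_mult tendsto_divide O1 J1 k\<alpha>) simp
    moreover have "\<forall>\<^sub>F n in sequentially. (card (Out n) / P n) / (J n * k n / P n) * (k n * \<alpha> n) = N n * \<alpha> n"
      using tpos
    proof eventually_elim
      case (elim n)
      then show ?case using Ppos[of n] kpos[of n] Jpos[OF elim] OJ[OF elim] by simp
    qed
    ultimately show ?thesis by (simp add: Lim_transform_eventually)
  qed
  \<comment> \<open>Shrinking the cells to their cores loses only the vanishing share
    \<open>d n / J n\<close> of the expected number of exceedances.\<close>
  have N\<delta>: "(\<lambda>n. N n * (d n * p n)) \<longlonglongrightarrow> 0"
  proof -
    have "(\<lambda>n. card (Out n) * p n * (d n / J n)) \<longlonglongrightarrow> \<tau> * 0" by (intro tendsto_mult Op d0)
    moreover have "\<forall>\<^sub>F n in sequentially. card (Out n) * p n * (d n / J n) = N n * (d n * p n)"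
      using tpos
    proof eventually_elim
      case (elim n)
      then show ?case using Jpos[OF elim] OJ[OF elim] by simp
    qed
    ultimately show ?thesis by (simp add: Lim_transform_eventually)
  qed
  have Nu: "(\<lambda>n. N n * (J n * p n)\<^sup>2) \<longlonglongrightarrow> 0"
  proof -
    have "(\<lambda>n. card (Out n) * p n * (J n * p n)) \<longlonglongrightarrow> \<tau> * 0" by (intro tendsto_mult Op u0)
    moreover have "\<forall>\<^sub>F n in sequentially. card (Out n) * p n * (J n * p n) = N n * (J n * p n)\<^sup>2"
      using tpos
    proof eventually_elim
      case (elim n)
      then show ?case using OJ[OF elim] by (simp add: power2_eq_square)
    qed
    ultimately show ?thesis by (simp add: Lim_transform_eventually)
  qed
  \<comment> \<open>The bound from \<open>maximum_error_chain\<close> with the factors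
    \<open>N n\<close> multiplied in, so that each summand has a known limit.\<close>
  define E where "E n = (card (Out n) * p n - card (D n) * p n) + (N n * \<alpha> n + 2 * (N n * (d n * p n)))
    + N n * (J n * p n)\<^sup>2 + (N n * \<alpha> n + N n * (d n * p n) + 3 ^ CARD('d) * (N n * (J n * p n)\<^sup>2))
    + \<bar>card (Out n) * p n - \<tau>\<bar>" for n
  have "E \<longlonglongrightarrow> (\<tau> - \<tau>) + (0 + 2 * 0) + 0 + (0 + 0 + 3 ^ CARD('d) * 0) + \<bar>\<tau> - \<tau>\<bar>"
    unfolding E_def by (intro tendsto_intros N\<alpha> N\<delta> Nu Op tail[folded p_def])
  then have E0: "E \<longlonglongrightarrow> 0" by simp
  have \<gamma>g: "\<bar>\<gamma> n $ l\<bar> < real_of_int (g n $ l)" for n l unfolding g_def by simp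
  \<comment> \<open>Coordinates in the triple block are at most \<open>2 * t\<close> in modulus;
    this bound places it in the window, where mixing is available.\<close>
  have triple: "\<forall>\<^sub>F n in sequentially. \<forall>l. 2 * (real_of_int (t n $ l) / c n $ l) < \<kappa>"
  proof -
    have "\<forall>\<^sub>F n in sequentially. 2 * (real_of_int (t n $ l) / c n $ l) < \<kappa>" for l
      using tendsto_mult[OF tendsto_const[of 2] int_sides_smallo[OF c k, of l]] \<kappa>
      unfolding t_def by (intro order_tendstoD(2)[of _ 0]) auto
    then have "\<forall>\<^sub>F n in sequentially. \<forall>l\<in>UNIV. 2 * (real_of_int (t n $ l) / c n $ l) < \<kappa>"
      by (intro eventually_ball_finite) auto
    then show ?thesis by simp
  qed
  have "\<forall>\<^sub>F n in sequentially. norm ((1 - prob (hit (x n) (D n))) - exp (- (\<tau> * \<pi> n))) \<le> E n"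
    using tpos triple
  proof eventually_elim
    case (elim n)
    then have t: "0 < t n $ l" for l by blast
    note cells = outer_cells_properties[OF t[unfolded t_def] fin[of n, unfolded Out_def], folded t_def Out_def Z_def]
    let ?W = "window (c n) \<kappa>"
    have mixn: "mixes (x n) ?W (\<alpha> n) (\<gamma> n)" using mixes_if_mixing_condition[OF mix, of n] .
    have ZW: "cell (t n) z \<subseteq> ?W" if "z \<in> Z n" for z
      using cells(1) out[of n] that unfolding Out_def by blast
    have tripleW: "triple_block (t n) \<subseteq> ?W"
    proof
      fix v assume v: "v \<in> triple_block (t n)"
      have "\<bar>real_of_int (v $ l)\<bar> \<le> \<kappa> * c n $ l" for l
      proof -
        have "- t n $ l \<le> v $ l" "v $ l < 2 * t n $ l" using v by (simp_all add: triple_block_def)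
        then have "\<bar>v $ l\<bar> \<le> 2 * t n $ l" using t[of l] by linarith
        then have "\<bar>real_of_int (v $ l)\<bar> \<le> 2 * real_of_int (t n $ l)" by linarith
        also have "\<dots> \<le> \<kappa> * c n $ l"
          using spec[OF elim(2), of l] c[of n l] by (simp add: pos_divide_less_eq)
        finally show ?thesis .
      qed
      then show "v \<in> ?W" by (simp add: mem_window[OF c])
    qed
    have DO: "D n \<subseteq> Out n" unfolding DC by (rule cells(4))
    have "real (card (Out n - D n)) = real (card (Out n)) - real (card (D n))"
      using DO fin[of n] by (simp add: card_Diff_subset finite_subset card_mono of_nat_diff)
    then have e: "card (Out n - D n) * prob (hit (x n) {0}) = card (Out n) * p n - card (D n) * p n"
      by (simp only: p_def left_diff_distrib)
    have h: "prob (hit (x n) (D n)) \<le> prob (hit (x n) (Out n))"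
      "prob (hit (x n) (Out n)) \<le> prob (hit (x n) (D n)) + (card (Out n) * p n - card (D n) * p n)"
      using prob_hit_mono[OF DO, of "x n"] prob_hit_subset_le[OF DO fin, of "x n"] unfolding e by blast+
    have pow: "\<bar>(1 - prob (hit (x n) (Out n))) - (1 - prob (hit (x n) (block (t n)))) ^ N n\<bar>
        \<le> N n * (\<alpha> n + 2 * (d n * p n))"
      using prob_hit_cells_approx[OF mixn \<gamma>g cells(2) ZW] unfolding cells(1) N_def d_def p_def .
    have q: "prob (hit (x n) (block (t n))) \<le> J n * p n"
      unfolding J_def p_def by (rule prob_hit_le) (rule finite_card_block)
    have f: "\<bar>prob (hit (x n) (block (t n))) - J n * prob (hit (x n) {0} - hit (x n) (later R (t n) 0))\<bar>
        \<le> \<alpha> n + d n * p n + 3 ^ CARD('d) * (J n * p n)\<^sup>2"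
      using prob_hit_block_approx[OF mixn \<gamma>g t tripleW R] unfolding J_def d_def p_def .
    have "successors R (c n) (k n) 0 = later R (t n) 0"
      unfolding t_def by (rule successors_eq[OF t[unfolded t_def]])
    then have \<pi>: "p n * \<pi> n = prob (hit (x n) {0} - hit (x n) (later R (t n) 0))" "0 \<le> \<pi> n" "\<pi> n \<le> 1"
      unfolding \<pi>_def p_def using cond_prob_field_max by simp_all
    have w: "N n * (J n * prob (hit (x n) {0} - hit (x n) (later R (t n) 0))) = card (Out n) * p n * \<pi> n"
      unfolding \<pi>(1)[symmetric] using OJ[OF elim(1)] by simp
    have "\<bar>(1 - prob (hit (x n) (D n))) - exp (- (\<tau> * \<pi> n))\<bar>
        \<le> (card (Out n) * p n - card (D n) * p n) + N n * (\<alpha> n + 2 * (d n * p n)) + N n * (J n * p n)\<^sup>2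
          + N n * (\<alpha> n + d n * p n + 3 ^ CARD('d) * (J n * p n)\<^sup>2) + \<bar>card (Out n) * p n - \<tau>\<bar>"
      by (rule maximum_error_chain[OF h pow measure_nonneg prob_le_1 q f w \<pi>(2,3) \<tau>])
    also have "\<dots> = E n" unfolding E_def by (simp add: distrib_left)
    finally show ?case by simp
  qed
  then have "(\<lambda>n. (1 - prob (hit (x n) (D n))) - exp (- (\<tau> * \<pi> n))) \<longlonglongrightarrow> 0"
    by (rule Lim_null_comparison) (rule E0)
  then show ?thesis unfolding \<pi>_def .
qed

end

section \<open>Choice of block numbers and the equivalence\<close>

text \<open>One null sequence \<open>u\<close> dominates \<open>\<alpha>\<close>, the reciprocals of
  \<open>c\<close> and the ratios of \<open>\<gamma>\<close> to \<open>c\<close>. Since a positive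
  integer is at least its root, \<open>k * u\<close> tending to 0 gives all three conditions at
  once.\<close>

lemma exists_slow_block_number:
  fixes c \<gamma> :: "nat \<Rightarrow> real^'d::finite" and \<alpha> :: "nat \<Rightarrow> real"
  assumes c: "\<And>n l. 0 < c n $ l" "\<And>l. filterlim (\<lambda>n. c n $ l) at_top sequentially"
    and \<alpha>: "\<alpha> \<longlonglongrightarrow> 0" and \<gamma>: "vec_smallo \<gamma> c"
  obtains k where "admissible c k" "(\<lambda>n. real (k n) * \<alpha> n) \<longlonglongrightarrow> 0"
    "vec_smallo (\<lambda>n. root CARD('d) (real (k n)) *\<^sub>R \<gamma> n) c"
proof -
  define u where "u n = \<bar>\<alpha> n\<bar> + (\<Sum>l\<in>UNIV. 1 / c n $ l + \<bar>\<gamma> n $ l / c n $ l\<bar>)" for n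
  have "u \<longlonglongrightarrow> \<bar>0\<bar> + (\<Sum>l\<in>(UNIV::'d set). 0 + \<bar>0\<bar>)"
    unfolding u_def using \<gamma> unfolding vec_smallo_def
    by (intro tendsto_add tendsto_rabs tendsto_sum \<alpha> tendsto_divide_0[OF tendsto_const]
        filterlim_at_top_imp_at_infinity c(2)) blast
  then have "u \<longlonglongrightarrow> 0" by simp
  then obtain k where k: "\<And>n. 0 < k n" "filterlim k at_top sequentially" "(\<lambda>n. real (k n) * u n) \<longlonglongrightarrow> 0"
    by (rule null_sequence_slow_growth) (rule that)
  have null: "f \<longlonglongrightarrow> 0" if "\<And>n. norm (f n) \<le> real (k n) * u n" for f :: "nat \<Rightarrow> real"
    by (rule Lim_null_comparison[OF eventuallyI k(3)]) (rule that)
  have s: "1 / c n $ l \<le> u n" "\<bar>\<gamma> n $ l / c n $ l\<bar> \<le> u n" "\<bar>\<alpha> n\<bar> \<le> u n" for n l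
  proof -
    have nn: "0 \<le> 1 / c n $ l + \<bar>\<gamma> n $ l / c n $ l\<bar>" for l using c(1)[of n l] by simp
    have "1 / c n $ l + \<bar>\<gamma> n $ l / c n $ l\<bar> \<le> (\<Sum>l\<in>UNIV. 1 / c n $ l + \<bar>\<gamma> n $ l / c n $ l\<bar>)"
      by (rule member_le_sum) (use nn in auto)
    moreover have "0 < 1 / c n $ l" using c(1)[of n l] by simp
    ultimately show "1 / c n $ l \<le> u n" "\<bar>\<gamma> n $ l / c n $ l\<bar> \<le> u n" unfolding u_def by linarith+
    show "\<bar>\<alpha> n\<bar> \<le> u n" unfolding u_def using nn by (simp add: sum_nonneg)
  qed
  have root: "0 \<le> root CARD('d) (real (k n))" "root CARD('d) (real (k n)) \<le> real (k n)" for n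
  proof -
    have k1: "1 \<le> real (k n)" using k(1)[of n] by simp
    then have "root CARD('d) (real (k n)) \<le> root CARD('d) (real (k n) ^ CARD('d))"
      by (intro real_root_le_mono self_le_power) auto
    then show "root CARD('d) (real (k n)) \<le> real (k n)" by (simp add: real_root_power_cancel)
  qed simp
  show thesis
  proof
    have "norm (root CARD('d) (real (k n)) / c n $ l) \<le> real (k n) * u n" for n l
    proof -
      have "norm (root CARD('d) (real (k n)) / c n $ l) = root CARD('d) (real (k n)) * (1 / c n $ l)"
        using root(1)[of n] c(1)[of n l] by simp
      also have "\<dots> \<le> real (k n) * u n"
        using root[of n] s(1)[of n l] c(1)[of n l] by (intro mult_mono) auto
      finally show ?thesis .
    qed
    then have "(\<lambda>n. root CARD('d) (real (k n)) / c n $ l) \<longlonglongrightarrow> 0" for l by (rule null)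
    then show "admissible c k" unfolding admissible_def using k(1,2) by blast
    show "(\<lambda>n. real (k n) * \<alpha> n) \<longlonglongrightarrow> 0"
    proof (rule null)
      fix n show "norm (real (k n) * \<alpha> n) \<le> real (k n) * u n"
        using s(3)[of n] by (simp add: abs_mult mult_left_mono)
    qed
    have "norm ((root CARD('d) (real (k n)) *\<^sub>R \<gamma> n) $ l / c n $ l) \<le> real (k n) * u n" for n l
    proof -
      have "norm ((root CARD('d) (real (k n)) *\<^sub>R \<gamma> n) $ l / c n $ l) = root CARD('d) (real (k n)) * \<bar>\<gamma> n $ l / c n $ l\<bar>"
        using root(1)[of n] by (simp add: abs_mult abs_divide)
      also have "\<dots> \<le> real (k n) * u n"
        using root[of n] s(2)[of n l] by (intro mult_mono) auto
      finally show ?thesis .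
    qed
    then have "(\<lambda>n. (root CARD('d) (real (k n)) *\<^sub>R \<gamma> n) $ l / c n $ l) \<longlonglongrightarrow> 0" for l by (rule null)
    then show "vec_smallo (\<lambda>n. root CARD('d) (real (k n)) *\<^sub>R \<gamma> n) c"
      unfolding vec_smallo_def by blast
  qed
qed

theorem theorem3p6:
  fixes M :: "'a measure"
    and \<xi> :: "int^'d::finite \<Rightarrow> 'a \<Rightarrow> real"
    and D :: "nat \<Rightarrow> (int^'d) set"
    and C :: "nat \<Rightarrow> (real^'d) set"
    and c :: "nat \<Rightarrow> real^'d"
    and \<kappa> \<theta> :: real
    and R :: "((int^'d) \<times> (int^'d)) set"
    and x :: "real \<Rightarrow> nat \<Rightarrow> real"
    and \<alpha> :: "real \<Rightarrow> nat \<Rightarrow> real"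
    and \<gamma> :: "real \<Rightarrow> nat \<Rightarrow> real^'d"
  assumes "geometric_assumption D C c"
    and "\<kappa> > 0"
    and "\<And>k n. admissible c k \<Longrightarrow> outer_cells (c n) (C n) (k n) \<subseteq> window (c n) \<kappa>"
    and "linear_order R" and "translation_invariant R"
    and "prob_space M" and "random_field M \<xi>" and "stationary M \<xi>"
    and "\<And>\<tau>. \<tau> > 0 \<Longrightarrow>
           (\<lambda>n. real (card (D n)) * \<P>(\<omega> in M. \<xi> 0 \<omega> > x \<tau> n)) \<longlonglongrightarrow> \<tau>"
    and "\<And>\<tau>. \<tau> > 0 \<Longrightarrow>
           mixing_condition M \<xi> c (x \<tau>) (\<lambda>n. window (c n) \<kappa>) (\<alpha> \<tau>) (\<gamma> \<tau>)"
    and "0 \<le> \<theta>" and "\<theta> \<le> 1"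
  shows "has_extremal_index M \<xi> D \<theta> \<longleftrightarrow>
    (\<exists>k :: real \<Rightarrow> nat \<Rightarrow> nat. \<forall>\<tau>>0.
       admissible c (k \<tau>) \<and>
       (\<lambda>n. real (k \<tau> n) * \<alpha> \<tau> n) \<longlonglongrightarrow> 0 \<and>
       vec_smallo (\<lambda>n. root CARD('d) (real (k \<tau> n)) *\<^sub>R \<gamma> \<tau> n) c \<and>
       local_condition M \<xi> R c (x \<tau>) (k \<tau>) \<theta>)"
proof -
  interpret prob_space M by fact
  interpret stationary_field M \<xi> by unfold_locales fact+
  note tail = assms(9)[unfolded prob_tail]
  note mix = assms(10)
  have c: "\<And>n l. 0 < c n $ l" "\<And>l. filterlim (\<lambda>n. c n $ l) at_top sequentially"
    using assms(1) unfolding geometric_assumption_def by blast+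
  \<comment> \<open>The requirements on block numbers that do not involve \<open>\<theta>\<close>;
    they suffice for the asymptotic identity.\<close>
  define good where "good \<tau> k \<longleftrightarrow> admissible c k \<and> (\<lambda>n. real (k n) * \<alpha> \<tau> n) \<longlonglongrightarrow> 0 \<and>
    vec_smallo (\<lambda>n. root CARD('d) (real (k n)) *\<^sub>R \<gamma> \<tau> n) c" for \<tau> and k :: "nat \<Rightarrow> nat"
  define P where "P \<tau> n = 1 - prob (hit (x \<tau> n) (D n))" for \<tau> n
  define \<pi> where "\<pi> \<tau> k n =
    \<P>(\<omega> in M. field_max \<xi> (successors R (c n) (k n) 0) \<omega> \<le> ereal (x \<tau> n) \<bar> \<xi> 0 \<omega> > x \<tau> n)"
    for \<tau> and k :: "nat \<Rightarrow> nat" and n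
  have key: "(\<lambda>n. P \<tau> n - exp (- (\<tau> * \<pi> \<tau> k n))) \<longlonglongrightarrow> 0" if "0 < \<tau>" "good \<tau> k" for \<tau> k
  proof -
    have k: "admissible c k" "(\<lambda>n. real (k n) * \<alpha> \<tau> n) \<longlonglongrightarrow> 0"
      "vec_smallo (\<lambda>n. root CARD('d) (real (k n)) *\<^sub>R \<gamma> \<tau> n) c"
      using that(2) by (simp_all add: good_def)
    show ?thesis unfolding P_def \<pi>_def
      by (rule prob_maximum_asymp[OF assms(1,2) assms(3)[OF k(1)] assms(4,5) tail[OF that(1)] less_imp_le[OF that(1)]
            mix[OF that(1)] k])
  qed
  have iff: "P \<tau> \<longlonglongrightarrow> exp (- (\<tau> * \<theta>)) \<longleftrightarrow> local_condition M \<xi> R c (x \<tau>) k \<theta>" if "0 < \<tau>" "good \<tau> k" for \<tau> k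
  proof
    assume "P \<tau> \<longlonglongrightarrow> exp (- (\<tau> * \<theta>))"
    then have "(\<lambda>n. P \<tau> n - (P \<tau> n - exp (- (\<tau> * \<pi> \<tau> k n)))) \<longlonglongrightarrow> exp (- (\<tau> * \<theta>)) - 0"
      using key[OF that] by (rule tendsto_diff)
    then have "(\<lambda>n. exp (- (\<tau> * \<pi> \<tau> k n))) \<longlonglongrightarrow> exp (- (\<tau> * \<theta>))" by simp
    \<comment> \<open>Because \<open>\<tau> > 0\<close>, taking logarithms and dividing by
      \<open>- \<tau>\<close> recovers the conditional probabilities.\<close>
    then have "(\<lambda>n. ln (exp (- (\<tau> * \<pi> \<tau> k n)))) \<longlonglongrightarrow> ln (exp (- (\<tau> * \<theta>)))"
      by (rule tendsto_ln) simp
    then have "(\<lambda>n. - (\<tau> * \<pi> \<tau> k n)) \<longlonglongrightarrow> - (\<tau> * \<theta>)" by simp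
    from tendsto_mult[OF tendsto_const[of "- (1 / \<tau>)"] this]
    have "(\<lambda>n. \<pi> \<tau> k n) \<longlonglongrightarrow> \<theta>" using that(1) by simp
    then show "local_condition M \<xi> R c (x \<tau>) k \<theta>"
      by (simp add: local_condition_def \<pi>_def)
  next
    assume "local_condition M \<xi> R c (x \<tau>) k \<theta>"
    then have "\<pi> \<tau> k \<longlonglongrightarrow> \<theta>" unfolding local_condition_def \<pi>_def .
    then have "(\<lambda>n. (P \<tau> n - exp (- (\<tau> * \<pi> \<tau> k n))) + exp (- (\<tau> * \<pi> \<tau> k n))) \<longlonglongrightarrow> 0 + exp (- (\<tau> * \<theta>))"
      by (intro tendsto_add key[OF that] tendsto_exp tendsto_minus tendsto_mult tendsto_const)
    then show "P \<tau> \<longlonglongrightarrow> exp (- (\<tau> * \<theta>))" by simp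
  qed
  have ex: "\<exists>k. good \<tau> k" if "0 < \<tau>" for \<tau>
  proof -
    have "\<alpha> \<tau> \<longlonglongrightarrow> 0" "vec_smallo (\<gamma> \<tau>) c" using mix[OF that] unfolding mixing_condition_def by blast+
    then show ?thesis
      by (rule exists_slow_block_number[OF c]) (unfold good_def, blast)
  qed
  \<comment> \<open>Any admissible block number gives finiteness; \<open>1\<close> is an arbitrary
    positive choice of \<open>\<tau>\<close>.\<close>
  have finD: "finite (D n)" for n
  proof -
    obtain k where "good 1 k" using ex[of 1] by auto
    then have k: "admissible c k" by (simp add: good_def)
    show ?thesis using card_asymp(1)[OF assms(1) k] finite_subset[OF assms(3)[OF k] finite_window[OF c(1)]] by blast
  qed
  \<comment> \<open>The extremal index admits any level sequence whose expected number of
    exceedances tends to \<open>\<tau>\<close>. For two such sequences the probabilities for the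
    maximum differ by at most the difference of these expected numbers, so the given sequence
    \<open>x \<tau>\<close> decides.\<close>
  have level: "(\<exists>y. (\<lambda>n. card (D n) * prob (hit (y n) {0})) \<longlonglongrightarrow> \<tau> \<and> (\<lambda>n. 1 - prob (hit (y n) (D n))) \<longlonglongrightarrow> L)
      \<longleftrightarrow> P \<tau> \<longlonglongrightarrow> L" if "0 < \<tau>" for \<tau> L
  proof
    assume "\<exists>y. (\<lambda>n. card (D n) * prob (hit (y n) {0})) \<longlonglongrightarrow> \<tau> \<and> (\<lambda>n. 1 - prob (hit (y n) (D n))) \<longlonglongrightarrow> L"
    then obtain y where y: "(\<lambda>n. card (D n) * prob (hit (y n) {0})) \<longlonglongrightarrow> \<tau>"
      "(\<lambda>n. 1 - prob (hit (y n) (D n))) \<longlonglongrightarrow> L" by blast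
    define e where "e n = \<bar>card (D n) * prob (hit (x \<tau> n) {0}) - card (D n) * prob (hit (y n) {0})\<bar>" for n
    have "e \<longlonglongrightarrow> \<bar>\<tau> - \<tau>\<bar>" unfolding e_def by (intro tendsto_rabs tendsto_diff tail[OF that] y(1))
    then have e: "e \<longlonglongrightarrow> 0" by simp
    have "norm (P \<tau> n - (1 - prob (hit (y n) (D n)))) \<le> e n" for n
    proof -
      have "norm (P \<tau> n - (1 - prob (hit (y n) (D n)))) = \<bar>prob (hit (x \<tau> n) (D n)) - prob (hit (y n) (D n))\<bar>"
        by (simp add: P_def abs_minus_commute)
      also have "\<dots> \<le> e n"
        using prob_hit_level_diff[OF finD, of "x \<tau> n" n "y n"]
        unfolding e_def right_diff_distrib[symmetric] abs_mult by simp
      finally show ?thesis .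
    qed
    then have "(\<lambda>n. P \<tau> n - (1 - prob (hit (y n) (D n)))) \<longlonglongrightarrow> 0"
      by (intro Lim_null_comparison[OF eventuallyI e])
    then have "(\<lambda>n. P \<tau> n - (1 - prob (hit (y n) (D n))) + (1 - prob (hit (y n) (D n)))) \<longlonglongrightarrow> 0 + L"
      using y(2) by (rule tendsto_add)
    then show "P \<tau> \<longlonglongrightarrow> L" by simp
  next
    assume "P \<tau> \<longlonglongrightarrow> L"
    then have "(\<lambda>n. 1 - prob (hit (x \<tau> n) (D n))) \<longlonglongrightarrow> L" unfolding P_def .
    with tail[OF that] show "\<exists>y. (\<lambda>n. card (D n) * prob (hit (y n) {0})) \<longlonglongrightarrow> \<tau> \<and>
      (\<lambda>n. 1 - prob (hit (y n) (D n))) \<longlonglongrightarrow> L" by blast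
  qed
  have index: "has_extremal_index M \<xi> D \<theta> \<longleftrightarrow> (\<forall>\<tau>>0. P \<tau> \<longlonglongrightarrow> exp (- (\<tau> * \<theta>)))"
    unfolding has_extremal_index_def prob_tail prob_field_max_le using level by (simp add: mult.commute)
  show ?thesis
  proof
    assume "has_extremal_index M \<xi> D \<theta>"
    then have lim: "P \<tau> \<longlonglongrightarrow> exp (- (\<tau> * \<theta>))" if "0 < \<tau>" for \<tau> using that index by blast
    \<comment> \<open>An arbitrary good choice works, since \<open>iff\<close> turns the limit of
      the maximum into the local condition for every good block number.\<close>
    have "\<forall>\<tau>. \<exists>k. 0 < \<tau> \<longrightarrow> good \<tau> k" using ex by blast
    from choice[OF this] obtain k where k: "\<And>\<tau>. 0 < \<tau> \<Longrightarrow> good \<tau> (k \<tau>)" by blast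
    show "\<exists>k :: real \<Rightarrow> nat \<Rightarrow> nat. \<forall>\<tau>>0.
       admissible c (k \<tau>) \<and>
       (\<lambda>n. real (k \<tau> n) * \<alpha> \<tau> n) \<longlonglongrightarrow> 0 \<and>
       vec_smallo (\<lambda>n. root CARD('d) (real (k \<tau> n)) *\<^sub>R \<gamma> \<tau> n) c \<and>
       local_condition M \<xi> R c (x \<tau>) (k \<tau>) \<theta>"
    proof (intro exI allI impI)
      fix \<tau> :: real assume \<tau>: "0 < \<tau>"
      show "admissible c (k \<tau>) \<and>
       (\<lambda>n. real (k \<tau> n) * \<alpha> \<tau> n) \<longlonglongrightarrow> 0 \<and>
       vec_smallo (\<lambda>n. root CARD('d) (real (k \<tau> n)) *\<^sub>R \<gamma> \<tau> n) c \<and>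
       local_condition M \<xi> R c (x \<tau>) (k \<tau>) \<theta>"
        using k[OF \<tau>] iff[OF \<tau> k[OF \<tau>]] lim[OF \<tau>] unfolding good_def by blast
    qed
  next
    assume "\<exists>k :: real \<Rightarrow> nat \<Rightarrow> nat. \<forall>\<tau>>0.
       admissible c (k \<tau>) \<and>
       (\<lambda>n. real (k \<tau> n) * \<alpha> \<tau> n) \<longlonglongrightarrow> 0 \<and>
       vec_smallo (\<lambda>n. root CARD('d) (real (k \<tau> n)) *\<^sub>R \<gamma> \<tau> n) c \<and>
       local_condition M \<xi> R c (x \<tau>) (k \<tau>) \<theta>"
    then obtain k where k: "\<And>\<tau>. 0 < \<tau> \<Longrightarrow> good \<tau> (k \<tau>) \<and> local_condition M \<xi> R c (x \<tau>) (k \<tau>) \<theta>"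
      unfolding good_def by blast
    have "P \<tau> \<longlonglongrightarrow> exp (- (\<tau> * \<theta>))" if "0 < \<tau>" for \<tau> using iff[of \<tau> "k \<tau>"] k[OF that] that by blast
    then show "has_extremal_index M \<xi> D \<theta>" using index by blast
  qed
qed

end
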